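(* Let $t\mapsto A(t)$ be a map from an open interval $I$ to $\mathbb{P}(2n)$ that is real analytic at $t_0\in I$. (i) If $d$ is a symplectic eigenvalue of $A(t_0)$ with multiplicity $m$, then for some $\epsilon>0$ there exist $m$ functions $\tilde d_1,\dots,\tilde d_m:(t_0-\epsilon,t_0+\epsilon)\to\mathbb{R}$ and $m$ pairs of maps $(\tilde u_1,\tilde v_1),\dots,(\tilde u_m,\tilde v_m):(t_0-\epsilon,t_0+\epsilon)\to\mathbb{R}^{2n}\times\mathbb{R}^{2n}$, all real analytic at $t_0$, such that for every $t$ the numbers $\tilde d_1(t),\dots,\tilde d_m(t)$ are symplectic eigenvalues of $A(t)$, $(\tilde u_j(t),\tilde v_j(t))$ is a symplectic eigenvector pair of $A(t)$ corresponding to $\tilde d_j(t)$ for $1\le j\le m$, the set $\{\tilde u_1(t),\dots,\tilde u_m(t),\tilde v_1(t),\dots,\tilde v_m(t)\}$ is symplectically orthonormal, and $\tilde d_j(t_0)=d$ for each $j$. (ii) There exists an $\epsilon>0$ such that all the $n$ symplectic eigenvalues of $A(t)$ and a corresponding symplectic eigenbasis can be chosen on $(t_0-\epsilon,t_0+\epsilon)$ to be real analytic at $t_0$; i.e. there are functions $\tilde d_1,\dots,\tilde d_n:(t_0-\epsilon,t_0+\epsilon)\to\mathbb{R}$ and $\tilde u_1,\dots,\tilde u_n,\tilde v_1,\dots,\tilde v_n:(t_0-\epsilon,t_0+\epsilon)\to\mathbb{R}^{2n}$, real analytic at $t_0$, such that for every $t$, $\tilde d_1(t),\dots,\tilde d_n(t)$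 are the $n$ symplectic eigenvalues of $A(t)$ counted with multiplicity and $\{\tilde u_1(t),\dots,\tilde u_n(t),\tilde v_1(t),\dots,\tilde v_n(t)\}$ is a symplectic eigenbasis of $A(t)$ corresponding to them.
   Context: Let $J=\begin{bmatrix}O & I_n\\ -I_n & O\end{bmatrix}$ ($2n\times 2n$). A real $2n\times 2n$ matrix $M$ is symplectic if $M^TJM=J$. $\mathbb{P}(2n)$ denotes the set of $2n\times 2n$ real symmetric positive definite matrices. By Williamson's theorem, for every $A\in\mathbb{P}(2n)$ there is a symplectic $M$ with $M^TAM=\begin{bmatrix}D&O\\O&D\end{bmatrix}$, $D=\mathrm{diag}(d_1(A),\dots,d_n(A))$, where $0<d_1(A)\le\dots\le d_n(A)$ are uniquely determined by $A$; they are the symplectic eigenvalues of $A$. A symplectic eigenvalue $d$ of $A$ has multiplicity $m$ if $\{i: d_i(A)=d\}$ has exactly $m$ elements. $\langle\cdot,\cdot\rangle$ is the Euclidean inner product. A pair $(u,v)$ of vectors in $\mathbb{R}^{2n}$ is a symplectic eigenvector pair of $A$ corresponding to $d$ if $Au=dJv$ and $Av=-dJu$. A set $\{u_1,\dots,u_m,v_1,\dots,v_m\}\subset\mathbb{R}^{2n}$ is symplectically orthonormal if $\langle u_i,Jv_j\rangle=\delta_{ij}$ and $\langle u_i,Ju_j\rangle=\langle v_i,Jv_j\rangle=0$ for all $i,j$; it is a symplectic basis if $m=n$. A symplectic eigenbasis of $A$ corresponding to $\tilde d_1,\dots,\tilde d_n$ is a symplectic basis $\{u_1,\dots,u_n,v_1,\dots,v_n\}$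 such that $(u_i,v_i)$ is a symplectic eigenvector pair of $A$ corresponding to $\tilde d_i$ for each $i$. A map is real analytic at $t_0$ if it is given by a convergent power series in $t-t_0$ on some neighbourhood of $t_0$. *)

theory Defs
  imports "HOL-Analysis.Analysis"
begin

text \<open>
  A vector in R^{2n} is an element of \<open>real ^ ('n + 'n)\<close> with \<open>n = CARD('n)\<close>: the indices
  \<open>Inl i\<close> are the first n coordinates, the indices \<open>Inr i\<close> the last n. The linear order
  on \<open>'n\<close> plays the role of the order of 1, ..., n.
\<close>

definition block_matrix ::
  "real^'n::finite^'n \<Rightarrow> real^'n^'n \<Rightarrow> real^'n^'n \<Rightarrow> real^'n^'n \<Rightarrow> real^('n + 'n)^('n + 'n)"
  where "block_matrix P Q R S = (\<chi> r c.
    (case r of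
       Inl i \<Rightarrow> (case c of Inl j \<Rightarrow> P $ i $ j | Inr j \<Rightarrow> Q $ i $ j)
     | Inr i \<Rightarrow> (case c of Inl j \<Rightarrow> R $ i $ j | Inr j \<Rightarrow> S $ i $ j)))"

definition diag_matrix :: "('n \<Rightarrow> real) \<Rightarrow> real^'n^'n"
  where "diag_matrix d = (\<chi> i j. if i = j then d i else 0)"

definition symp_J :: "real^('n::finite + 'n)^('n + 'n)"
  where "symp_J = block_matrix 0 (mat 1) (- mat 1) 0"

definition symplectic :: "real^('n::finite + 'n)^('n + 'n) \<Rightarrow> bool"
  where "symplectic M \<longleftrightarrow> transpose M ** symp_J ** M = symp_J"

definition pos_def_matrix :: "real^'m^'m \<Rightarrow> bool"
  where "pos_def_matrix A \<longleftrightarrow> transpose A = A \<and> (\<forall>x. x \<noteq> 0 \<longrightarrow> 0 < x \<bullet> (A *v x))"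

text \<open>\<open>symp_eigval A i\<close> is \<open>d\<^sub>i(A)\<close>. For positive definite \<open>A\<close>, existence and uniqueness
  of the description below are Williamson's theorem; for other \<open>A\<close> the value is meaningless.\<close>

definition symp_eigval :: "real^('n::{finite,linorder} + 'n)^('n + 'n) \<Rightarrow> 'n \<Rightarrow> real"
  where "symp_eigval A = (THE d. (\<forall>i. 0 < d i) \<and> mono d \<and>
    (\<exists>M. symplectic M \<and>
         transpose M ** A ** M = block_matrix (diag_matrix d) 0 0 (diag_matrix d)))"

definition is_symp_eigval :: "real^('n::{finite,linorder} + 'n)^('n + 'n) \<Rightarrow> real \<Rightarrow> bool"
  where "is_symp_eigval A d \<longleftrightarrow> (\<exists>i. symp_eigval A i = d)"

definition symp_multiplicity :: "real^('n::{finite,linorder} + 'n)^('n + 'n) \<Rightarrow> real \<Rightarrow> nat"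
  where "symp_multiplicity A d = card {i. symp_eigval A i = d}"

definition symp_eigenpair ::
  "real^('n::finite + 'n)^('n + 'n) \<Rightarrow> real \<Rightarrow> real^('n + 'n) \<Rightarrow> real^('n + 'n) \<Rightarrow> bool"
  where "symp_eigenpair A d u v \<longleftrightarrow>
    A *v u = d *\<^sub>R (symp_J *v v) \<and> A *v v = (- d) *\<^sub>R (symp_J *v u)"

definition symp_orthonormal ::
  "'k set \<Rightarrow> ('k \<Rightarrow> real^('n::finite + 'n)) \<Rightarrow> ('k \<Rightarrow> real^('n + 'n)) \<Rightarrow> bool"
  where "symp_orthonormal K u v \<longleftrightarrow> (\<forall>i\<in>K. \<forall>j\<in>K.
    u i \<bullet> (symp_J *v v j) = (if i = j then 1 else 0) \<and>
    u i \<bullet> (symp_J *v u j) = 0 \<and> v i \<bullet> (symp_J *v v j) = 0)"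

text \<open>Indexing the family by the whole type \<open>'n\<close> expresses that it has n pairs.\<close>

definition symp_basis :: "('n \<Rightarrow> real^('n::finite + 'n)) \<Rightarrow> ('n \<Rightarrow> real^('n + 'n)) \<Rightarrow> bool"
  where "symp_basis u v \<longleftrightarrow> symp_orthonormal UNIV u v"

definition symp_eigenbasis ::
  "real^('n::finite + 'n)^('n + 'n) \<Rightarrow> ('n \<Rightarrow> real) \<Rightarrow>
   ('n \<Rightarrow> real^('n + 'n)) \<Rightarrow> ('n \<Rightarrow> real^('n + 'n)) \<Rightarrow> bool"
  where "symp_eigenbasis A d u v \<longleftrightarrow>
    symp_basis u v \<and> (\<forall>i. symp_eigenpair A (d i) (u i) (v i))"

text \<open>Depends only on the values of \<open>f\<close> near \<open>t0\<close>, so it also serves for maps that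
  are only meaningful on an open interval around \<open>t0\<close>.\<close>

definition real_analytic_at :: "(real \<Rightarrow> 'a::real_normed_vector) \<Rightarrow> real \<Rightarrow> bool"
  where "real_analytic_at f t0 \<longleftrightarrow>
    (\<exists>c r. 0 < r \<and> (\<forall>t. \<bar>t - t0\<bar> < r \<longrightarrow> (\<lambda>k. (t - t0) ^ k *\<^sub>R c k) sums f t))"

end

theory Submission
  imports Defs "HOL-Complex_Analysis.Cauchy_Integral_Formula"
begin

text \<open>
  With \<open>B = J A\<close>, a pair \<open>(u, v)\<close> is a symplectic eigenvector pair for \<open>d\<close> iff \<open>B u = - d v\<close> and
  \<open>B v = d u\<close>. The matrix \<open>B\<close> is skew for the inner product \<open>\<langle>x, A y\<rangle>\<close>, so \<open>B\<^sup>2\<close> is self-adjoint,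
  and a real analytic \<open>A\<close>-orthogonal projection \<open>P\<close> commuting with \<open>B\<close> on whose range \<open>B\<^sup>2\<close> is a
  scalar \<open>a < 0\<close> yields the pair \<open>u = P w\<close> (rescaled), \<open>v = - B u / d\<close> with \<open>d = \<surd>(-a)\<close>.

  Such a \<open>P\<close> is found by Rellich's reduction. If \<open>B\<^sup>2\<close> is not scalar on the range of \<open>P\<close>, then
  \<open>B\<^sup>2 P - a P = (t - t\<^sub>0)\<^sup>k K\<close> for a Rayleigh quotient \<open>a\<close>, where \<open>K\<close> is analytic and \<open>K(t\<^sub>0)\<close> is not scalar on the
  range of \<open>P(t\<^sub>0)\<close>. A high power of an affine rescaling of \<open>K\<close> is almost idempotent at \<open>t\<^sub>0\<close>; it is
  corrected to an analytic idempotent that splits \<open>P\<close>. Ranks decrease, so this stops. Splitting off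
  the pair \<open>(u, v)\<close> and repeating produces the whole eigenbasis.
\<close>

subsection \<open>Real analytic maps\<close>

text \<open>Symplectic eigenvalues listed in increasing order need not be analytic where branches
  cross, and a projection that is natural at \<open>t0\<close> may collect branches that separate
  only for t \<noteq> t0. Dividing by (t - t0)^k magnifies their difference until it shows at
  \<open>t0\<close> itself. The Rayleigh quotient serves to recognise this: the quadratic form of
  \<open>K\<close> vanishes along P(t) w, this survives the division, and a nonzero selfadjoint
  matrix on the range of P(t0) with such a null vector is not scalar there. Powers take the place of
  a contour integral of the resolvent: once the spectrum fills [0,1] up to both ends, repeated
  squaring sends everything below 1 to 0. The correction to an idempotent is a limit, so it is
  carried out over the complex numbers, where locally uniform limits stay holomorphic. Projections
  are carried instead of bases because commutation and selfadjointness are closed linear conditions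
  and pass to these limits. Part (i) is read off from part (ii) by keeping the indices whose
  eigenvalue at \<open>t0\<close> is d.\<close>

lemma Re_mult_of_real: "Re (z * of_real x) = Re z * x"
  by simp

text \<open>A real power series converges on the complex disc of the same radius, and a holomorphic
  extension has a Taylor series. Products, inverses, roots and uniform limits of real analytic
  functions are thereby reduced to holomorphic ones.\<close>

lemma real_analytic_at_iff_complex:
  fixes f :: "real \<Rightarrow> real"
  shows "real_analytic_at f t0 \<longleftrightarrow>
    (\<exists>F. F analytic_on {complex_of_real t0} \<and>
         (\<forall>\<^sub>F t in nhds t0. F (of_real t) = of_real (f t)))"
proof
  assume "real_analytic_at f t0"
  then obtain c r where r: "0 < r"
    and sm: "\<And>t. \<bar>t - t0\<bar> < r \<Longrightarrow> (\<lambda>k. (t - t0) ^ k *\<^sub>R c k) sums f t"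
    unfolding real_analytic_at_def by blast
  define a where "a n = complex_of_real (c n)" for n
  define F where "F w = (\<Sum>n. a n * (w - of_real t0) ^ n)" for w
  have "(\<lambda>n. a n * (w - of_real t0) ^ n) sums F w" if "w \<in> ball (of_real t0) r" for w
  proof -
    have "norm (w - of_real t0) < r" using that by (simp add: dist_norm norm_minus_commute)
    \<comment> \<open>A real point t0 + s slightly farther out than w: convergence there forces
      convergence at w.\<close>
    then obtain s where s: "norm (w - of_real t0) < s" "s < r" using dense by blast
    have s0: "0 \<le> s" using s(1) norm_ge_zero[of "w - of_real t0"] by linarith
    have "(\<lambda>k. s ^ k *\<^sub>R c k) sums f (t0 + s)" using sm[of "t0 + s"] s s0 by simp
    then have "summable (\<lambda>k. c k * s ^ k)" by (simp add: sums_iff mult.commute)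
    then have "summable (\<lambda>k. complex_of_real (c k * s ^ k))" by (rule summable_of_real)
    then have "summable (\<lambda>k. a k * of_real s ^ k)" by (simp add: a_def)
    from powser_inside[OF this, of "w - of_real t0"] show ?thesis
      using s s0 unfolding F_def by (simp add: summable_sums)
  qed
  then have "F analytic_on ball (of_real t0) r" by (rule power_series_analytic)
  then have "F analytic_on {of_real t0}" by (rule analytic_on_subset) (use r in auto)
  moreover have "F (of_real t) = of_real (f t)" if "\<bar>t - t0\<bar> < r" for t
  proof -
    have "(\<lambda>k. complex_of_real ((t - t0) ^ k *\<^sub>R c k)) sums of_real (f t)"
      using sm[OF that] by (rule sums_of_real)
    then have "(\<lambda>n. a n * (of_real t - of_real t0) ^ n) sums of_real (f t)"
      by (simp add: a_def mult.commute)
    then show ?thesis unfolding F_def by (simp add: sums_iff)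
  qed
  moreover have "\<forall>\<^sub>F t in nhds t0. \<bar>t - t0\<bar> < r"
    using r by (auto simp: eventually_nhds_metric dist_real_def)
  ultimately show "\<exists>F. F analytic_on {complex_of_real t0} \<and>
         (\<forall>\<^sub>F t in nhds t0. F (of_real t) = of_real (f t))"
    by (metis (mono_tags, lifting) eventually_mono)
next
  assume "\<exists>F. F analytic_on {complex_of_real t0} \<and>
         (\<forall>\<^sub>F t in nhds t0. F (of_real t) = of_real (f t))"
  then obtain F e d where e: "0 < e" and F: "F holomorphic_on ball (of_real t0) e"
    and d: "0 < d" and Ff: "\<And>t. \<bar>t - t0\<bar> < d \<Longrightarrow> F (of_real t) = complex_of_real (f t)"
    by (auto simp: analytic_at_ball eventually_nhds_metric dist_real_def)
  \<comment> \<open>Near \<open>t0\<close> the values of F on the real axis are real, so passing to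
    real parts term by term still sums to f.\<close>
  define c where "c n = Re ((deriv ^^ n) F (of_real t0) / fact n)" for n
  have "(\<lambda>k. (t - t0) ^ k *\<^sub>R c k) sums f t" if t: "\<bar>t - t0\<bar> < min e d" for t
  proof -
    have "of_real t \<in> ball (complex_of_real t0) e"
      using t by (simp add: dist_norm abs_minus_commute flip: of_real_diff)
    from holomorphic_power_series[OF F this]
    have "(\<lambda>n. (deriv ^^ n) F (of_real t0) / fact n * (of_real ((t - t0) ^ n))) sums of_real (f t)"
      using Ff[of t] t by simp
    from sums_Re[OF this] show ?thesis
      unfolding c_def Re_mult_of_real Re_complex_of_real by (simp only: real_scaleR_def mult.commute)
  qed
  then show "real_analytic_at f t0"
    unfolding real_analytic_at_def using e d by (intro exI[of _ c] exI[of _ "min e d"]) auto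
qed

lemma real_analytic_at_bounded_linear:
  assumes "bounded_linear h" "real_analytic_at f t0"
  shows "real_analytic_at (\<lambda>t. h (f t)) t0"
proof -
  interpret bounded_linear h by fact
  obtain c r where r: "0 < r"
    and sm: "\<And>t. \<bar>t - t0\<bar> < r \<Longrightarrow> (\<lambda>k. (t - t0) ^ k *\<^sub>R c k) sums f t"
    using assms(2) unfolding real_analytic_at_def by blast
  show ?thesis unfolding real_analytic_at_def
    by (rule exI[of _ "\<lambda>k. h (c k)"], rule exI[of _ r]) (use r sums[OF sm] in \<open>auto simp: scaleR\<close>)
qed

lemma real_analytic_at_const [simp, intro]: "real_analytic_at (\<lambda>t. c) t0"
proof -
  have "(\<lambda>k. (t - t0) ^ k *\<^sub>R (if k = 0 then c else 0)) sums c" for t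
  proof -
    have "(\<lambda>k. (t - t0) ^ k *\<^sub>R (if k = 0 then c else 0)) = (\<lambda>k. if k = 0 then c else 0)"
      by (auto simp: fun_eq_iff)
    then show ?thesis using sums_single[of 0 "\<lambda>_. c"] by simp
  qed
  then show ?thesis unfolding real_analytic_at_def
    by (intro exI[of _ "\<lambda>k. if k = 0 then c else 0"] exI[of _ "1::real"]) auto
qed

lemma real_analytic_at_add:
  assumes "real_analytic_at f t0" "real_analytic_at g t0"
  shows "real_analytic_at (\<lambda>t. f t + g t) t0"
proof -
  obtain c r where r: "0 < r"
    and c: "\<And>t. \<bar>t - t0\<bar> < r \<Longrightarrow> (\<lambda>k. (t - t0) ^ k *\<^sub>R c k) sums f t"
    using assms(1) unfolding real_analytic_at_def by blast
  obtain d s where s: "0 < s"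
    and d: "\<And>t. \<bar>t - t0\<bar> < s \<Longrightarrow> (\<lambda>k. (t - t0) ^ k *\<^sub>R d k) sums g t"
    using assms(2) unfolding real_analytic_at_def by blast
  show ?thesis unfolding real_analytic_at_def
    by (rule exI[of _ "\<lambda>k. c k + d k"], rule exI[of _ "min r s"])
      (use r s sums_add[OF c d] in \<open>auto simp: scaleR_add_right\<close>)
qed

lemma real_analytic_at_minus:
  "real_analytic_at f t0 \<Longrightarrow> real_analytic_at (\<lambda>t. - f t) t0"
  by (rule real_analytic_at_bounded_linear[OF bounded_linear_minus[OF bounded_linear_ident]])

lemma real_analytic_at_diff:
  assumes "real_analytic_at f t0" "real_analytic_at g t0"
  shows "real_analytic_at (\<lambda>t. f t - g t) t0"
  using real_analytic_at_add[OF assms(1) real_analytic_at_minus[OF assms(2)]] by simp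

lemma real_analytic_at_sum:
  assumes "\<And>i. i \<in> S \<Longrightarrow> real_analytic_at (f i) t0"
  shows "real_analytic_at (\<lambda>t. \<Sum>i\<in>S. f i t) t0"
  using assms by (induction S rule: infinite_finite_induct) (auto intro: real_analytic_at_add)

lemma real_analytic_at_mult:
  fixes f g :: "real \<Rightarrow> real"
  assumes "real_analytic_at f t0" "real_analytic_at g t0"
  shows "real_analytic_at (\<lambda>t. f t * g t) t0"
proof -
  obtain F G where "F analytic_on {complex_of_real t0}" "G analytic_on {complex_of_real t0}"
    and ev: "\<forall>\<^sub>F t in nhds t0. F (of_real t) = complex_of_real (f t)"
      "\<forall>\<^sub>F t in nhds t0. G (of_real t) = complex_of_real (g t)"
    using assms unfolding real_analytic_at_iff_complex by blast
  then have "(\<lambda>z. F z * G z) analytic_on {of_real t0}" by (intro analytic_on_mult)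
  moreover have "\<forall>\<^sub>F t in nhds t0. F (of_real t) * G (of_real t) = of_real (f t * g t)"
    using ev by eventually_elim simp
  ultimately show ?thesis
    unfolding real_analytic_at_iff_complex by (intro exI[of _ "\<lambda>z. F z * G z"]) simp
qed

lemma real_analytic_at_inverse:
  fixes f :: "real \<Rightarrow> real"
  assumes "real_analytic_at f t0" "f t0 \<noteq> 0"
  shows "real_analytic_at (\<lambda>t. inverse (f t)) t0"
proof -
  obtain F where F: "F analytic_on {complex_of_real t0}"
    and ev: "\<forall>\<^sub>F t in nhds t0. F (of_real t) = complex_of_real (f t)"
    using assms(1) unfolding real_analytic_at_iff_complex by blast
  have "F (of_real t0) \<noteq> 0" using eventually_nhds_x_imp_x[OF ev] assms(2) by simp
  then have "(\<lambda>z. inverse (F z)) analytic_on {of_real t0}" using F by (intro analytic_on_inverse) auto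
  moreover have "\<forall>\<^sub>F t in nhds t0. inverse (F (of_real t)) = of_real (inverse (f t))"
    using ev by eventually_elim simp
  ultimately show ?thesis
    unfolding real_analytic_at_iff_complex by (intro exI[of _ "\<lambda>z. inverse (F z)"]) simp
qed

lemma real_analytic_at_divide:
  fixes f g :: "real \<Rightarrow> real"
  assumes "real_analytic_at f t0" "real_analytic_at g t0" "g t0 \<noteq> 0"
  shows "real_analytic_at (\<lambda>t. f t / g t) t0"
  using real_analytic_at_mult[OF assms(1) real_analytic_at_inverse[OF assms(2,3)]]
  by (simp add: field_simps)

lemma isCont_real_analytic_at_real:
  fixes f :: "real \<Rightarrow> real"
  assumes "real_analytic_at f t0"
  shows "isCont f t0"
proof -
  obtain F where F: "F analytic_on {complex_of_real t0}"
    and ev: "\<forall>\<^sub>F t in nhds t0. F (of_real t) = complex_of_real (f t)"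
    using assms unfolding real_analytic_at_iff_complex by blast
  obtain e where e: "e > 0" "F holomorphic_on ball (of_real t0) e"
    using F by (auto simp: analytic_at_ball)
  then have "isCont F (of_real t0)"
    using holomorphic_on_imp_continuous_on[OF e(2)] by (simp add: continuous_on_eq_continuous_at)
  then have "isCont (\<lambda>t. Re (F (of_real t))) t0"
    by (intro isCont_o2[of t0 complex_of_real "\<lambda>z. Re (F z)"] continuous_Re continuous_of_real) auto
  moreover have "\<forall>\<^sub>F t in nhds t0. Re (F (of_real t)) = f t"
    using ev by eventually_elim simp
  ultimately show ?thesis using isCont_cong by fast
qed

text \<open>Positivity at \<open>t0\<close> keeps the extension off the branch cut of
  \<open>csqrt\<close>.\<close>

lemma real_analytic_at_sqrt:
  fixes f :: "real \<Rightarrow> real"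
  assumes "real_analytic_at f t0" "f t0 > 0"
  shows "real_analytic_at (\<lambda>t. sqrt (f t)) t0"
proof -
  obtain F where F: "F analytic_on {complex_of_real t0}"
    and ev: "\<forall>\<^sub>F t in nhds t0. F (of_real t) = complex_of_real (f t)"
    using assms(1) unfolding real_analytic_at_iff_complex by blast
  have Ft0: "F (of_real t0) = of_real (f t0)" using eventually_nhds_x_imp_x[OF ev] .
  then have "csqrt analytic_on (F ` {of_real t0})"
    using assms(2) by (intro analytic_on_subset[OF analytic_on_csqrt]) (auto simp: complex_nonpos_Reals_iff)
  with F have "(csqrt \<circ> F) analytic_on {of_real t0}" by (rule analytic_on_compose)
  moreover have "\<forall>\<^sub>F t in nhds t0. 0 < f t"
    using isCont_real_analytic_at_real[OF assms(1)] assms(2) order_tendstoD(1)[of f "f t0" "nhds t0" 0]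
    by (simp add: continuous_at tendsto_at_iff_tendsto_nhds)
  then have "\<forall>\<^sub>F t in nhds t0. (csqrt \<circ> F) (of_real t) = of_real (sqrt (f t))"
    using ev by eventually_elim (simp add: csqrt_of_real_nonneg)
  ultimately show ?thesis unfolding real_analytic_at_iff_complex by blast
qed

text \<open>There are finitely many components, so the least of their radii is positive and serves
  all of them.\<close>

lemma real_analytic_at_vec_iff:
  fixes f :: "real \<Rightarrow> 'a::real_normed_vector ^ 'm"
  shows "real_analytic_at f t0 \<longleftrightarrow> (\<forall>i. real_analytic_at (\<lambda>t. f t $ i) t0)"
proof
  assume "real_analytic_at f t0"
  then show "\<forall>i. real_analytic_at (\<lambda>t. f t $ i) t0"
    by (auto intro: real_analytic_at_bounded_linear[OF bounded_linear_vec_nth])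
next
  assume "\<forall>i. real_analytic_at (\<lambda>t. f t $ i) t0"
  then obtain c r where r: "\<And>i. 0 < r i"
    and c: "\<And>i t. \<bar>t - t0\<bar> < r i \<Longrightarrow> (\<lambda>k. (t - t0) ^ k *\<^sub>R c i k) sums (f t $ i)"
    unfolding real_analytic_at_def by metis
  have "(\<lambda>k. (t - t0) ^ k *\<^sub>R (\<chi> i. c i k)) sums f t" if "\<bar>t - t0\<bar> < Min (range r)" for t
    unfolding sums_def
  proof (rule vec_tendstoI)
    fix i
    have "\<bar>t - t0\<bar> < r i" using that by simp
    from c[OF this] show "(\<lambda>n. (\<Sum>k<n. (t - t0) ^ k *\<^sub>R (\<chi> i. c i k)) $ i) \<longlonglongrightarrow> f t $ i"
      by (simp add: sums_def sum_component)
  qed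
  moreover have "0 < Min (range r)" using r by simp
  ultimately show "real_analytic_at f t0" unfolding real_analytic_at_def
    by (intro exI[of _ "\<lambda>k. \<chi> i. c i k"] exI[of _ "Min (range r)"]) simp
qed

lemma isCont_real_analytic_at_vec:
  fixes f :: "real \<Rightarrow> real ^ 'm"
  assumes "real_analytic_at f t0"
  shows "isCont f t0"
  unfolding isCont_def
proof (rule vec_tendstoI)
  fix i
  have "isCont (\<lambda>t. f t $ i) t0"
    using assms isCont_real_analytic_at_real unfolding real_analytic_at_vec_iff[of f] by blast
  then show "((\<lambda>x. f x $ i) \<longlongrightarrow> f t0 $ i) (at t0)" by (simp add: isCont_def)
qed

lemma isCont_real_analytic_at_matrix:
  fixes f :: "real \<Rightarrow> real ^ 'm ^ 'k"
  assumes "real_analytic_at f t0"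
  shows "isCont f t0"
  unfolding isCont_def
proof (rule vec_tendstoI)
  fix i
  have "isCont (\<lambda>t. f t $ i) t0"
    using assms isCont_real_analytic_at_vec unfolding real_analytic_at_vec_iff[of f] by blast
  then show "((\<lambda>x. f x $ i) \<longlongrightarrow> f t0 $ i) (at t0)" by (simp add: isCont_def)
qed

lemma real_analytic_at_scaleR:
  fixes f :: "real \<Rightarrow> real ^ 'm"
  assumes "real_analytic_at a t0" "real_analytic_at f t0"
  shows "real_analytic_at (\<lambda>t. a t *\<^sub>R f t) t0"
  using assms by (auto simp: real_analytic_at_vec_iff[of f] real_analytic_at_vec_iff[of "\<lambda>t. a t *\<^sub>R f t"]
      intro: real_analytic_at_mult)

lemma real_analytic_at_scaleR_matrix:
  fixes f :: "real \<Rightarrow> real ^ 'm ^ 'k"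
  assumes "real_analytic_at a t0" "real_analytic_at f t0"
  shows "real_analytic_at (\<lambda>t. a t *\<^sub>R f t) t0"
  using assms by (auto simp: real_analytic_at_vec_iff[of f] real_analytic_at_vec_iff[of "\<lambda>t. a t *\<^sub>R f t"]
      intro: real_analytic_at_scaleR)

lemma real_analytic_at_inner:
  fixes f g :: "real \<Rightarrow> real ^ 'm"
  assumes "real_analytic_at f t0" "real_analytic_at g t0"
  shows "real_analytic_at (\<lambda>t. f t \<bullet> g t) t0"
  using assms unfolding inner_vec_def real_analytic_at_vec_iff inner_real_def
  by (auto intro!: real_analytic_at_sum real_analytic_at_mult)

lemma real_analytic_at_matrix_vector_mult:
  fixes f :: "real \<Rightarrow> real ^ 'm ^ 'k"
  assumes "real_analytic_at f t0" "real_analytic_at g t0"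
  shows "real_analytic_at (\<lambda>t. f t *v g t) t0"
  using assms unfolding matrix_vector_mult_def real_analytic_at_vec_iff
  by (auto intro!: real_analytic_at_sum real_analytic_at_mult)

lemma real_analytic_at_matrix_matrix_mult:
  fixes f :: "real \<Rightarrow> real ^ 'm ^ 'k" and g :: "real \<Rightarrow> real ^ 'l ^ 'm"
  assumes "real_analytic_at f t0" "real_analytic_at g t0"
  shows "real_analytic_at (\<lambda>t. f t ** g t) t0"
  using assms unfolding matrix_matrix_mult_def real_analytic_at_vec_iff
  by (auto intro!: real_analytic_at_sum real_analytic_at_mult)

lemmas real_analytic_intros = real_analytic_at_const real_analytic_at_add real_analytic_at_diff
  real_analytic_at_minus real_analytic_at_mult real_analytic_at_divide real_analytic_at_sqrt
  real_analytic_at_scaleR real_analytic_at_scaleR_matrix real_analytic_at_inner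
  real_analytic_at_matrix_vector_mult real_analytic_at_matrix_matrix_mult

text \<open>Either all coefficients vanish or there is a first nonzero one, whose index is the order
  of vanishing. This is where analyticity is essential: a smooth map can vanish to infinite order
  without being zero near \<open>t0\<close>.\<close>

lemma real_analytic_at_factor:
  assumes "real_analytic_at f t0"
  obtains "\<forall>\<^sub>F t in nhds t0. f t = 0"
  | k g where "real_analytic_at g t0" "g t0 \<noteq> 0" "\<forall>\<^sub>F t in nhds t0. f t = (t - t0) ^ k *\<^sub>R g t"
proof -
  obtain c r where r: "0 < r"
    and sm: "\<And>t. \<bar>t - t0\<bar> < r \<Longrightarrow> (\<lambda>k. (t - t0) ^ k *\<^sub>R c k) sums f t"
    using assms(1) unfolding real_analytic_at_def by blast
  have ev: "\<forall>\<^sub>F t in nhds t0. \<bar>t - t0\<bar> < r"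
    using r by (auto simp: eventually_nhds_metric dist_real_def)
  show ?thesis
  proof (cases "\<forall>k. c k = 0")
    case True
    then have "f t = 0" if "\<bar>t - t0\<bar> < r" for t
      using sm[OF that] by (simp add: sums_iff)
    with ev show ?thesis by (intro that(1)) (auto elim: eventually_mono)
  next
    case False
    define k where "k = (LEAST k. c k \<noteq> 0)"
    have k: "c k \<noteq> 0" using False unfolding k_def by (metis (mono_tags, lifting) LeastI)
    have lt: "c j = 0" if "j < k" for j using that not_less_Least unfolding k_def by blast
    \<comment> \<open>The quotient has a removable singularity at \<open>t0\<close>; its limit there
      is the leading coefficient.\<close>
    define g where "g t = (if t = t0 then c k else inverse ((t - t0) ^ k) *\<^sub>R f t)" for t
    have f: "f t = (t - t0) ^ k *\<^sub>R g t" if t: "\<bar>t - t0\<bar> < r" for t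
    proof (cases "t = t0")
      case True
      have "(\<lambda>j. (t - t0) ^ j *\<^sub>R c j) = (\<lambda>j. if j = 0 then c 0 else 0)"
        using True by (auto simp: fun_eq_iff)
      moreover have "(\<lambda>j. if j = 0 then c 0 else 0) sums c 0" using sums_single[of 0 "\<lambda>_. c 0"] by simp
      ultimately have "f t = c 0" using sm[OF t] sums_unique2 by fastforce
      \<comment> \<open>For k = 0 the factor is 0^0 = 1 and both sides are c 0; for k > 0 both sides
        vanish.\<close>
      then show ?thesis using True lt[of 0] by (cases "k = 0") (auto simp: g_def)
    qed (simp add: g_def)
    have g: "(\<lambda>j. (t - t0) ^ j *\<^sub>R c (j + k)) sums g t" if t: "\<bar>t - t0\<bar> < r" for t
    proof (cases "t = t0")
      case True
      have "(\<lambda>j. (t - t0) ^ j *\<^sub>R c (j + k)) = (\<lambda>j. if j = 0 then c k else 0)"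
        using True by (auto simp: fun_eq_iff)
      then show ?thesis using True sums_single[of 0 "\<lambda>_. c k"] by (simp add: g_def)
    next
      case False
      have "(\<lambda>j. (t - t0) ^ (j + k) *\<^sub>R c (j + k)) sums f t"
        by (subst sums_zero_iff_shift) (use lt sm[OF t] in auto)
      from sums_scaleR_right[OF this, of "inverse ((t - t0) ^ k)"]
      moreover have "inverse ((t - t0) ^ k) *\<^sub>R (t - t0) ^ (j + k) *\<^sub>R c (j + k) = (t - t0) ^ j *\<^sub>R c (j + k)"
        for j using False by (simp add: power_add)
      ultimately show ?thesis using False by (simp only: g_def if_False)
    qed
    show ?thesis
    proof (rule that(2)[of g k])
      show "real_analytic_at g t0" unfolding real_analytic_at_def using g r
        by (intro exI[of _ "\<lambda>j. c (j + k)"] exI[of _ r]) auto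
      show "g t0 \<noteq> 0" using k by (simp add: g_def)
      show "\<forall>\<^sub>F t in nhds t0. f t = (t - t0) ^ k *\<^sub>R g t"
        using ev by eventually_elim (rule f)
    qed
  qed
qed

subsection \<open>Analytic correction of almost idempotent matrices\<close>

lemma matrix_add_rdistrib: "(A + B) ** C = A ** C + B ** (C :: 'a::semiring_1 ^ 'm ^ 'n)"
  by (simp add: vec_eq_iff matrix_matrix_mult_def sum.distrib distrib_right)

lemma matrix_diff_ldistrib: "A ** (B - C) = A ** B - A ** (C :: 'a::ring_1 ^ 'm ^ 'n)"
  by (simp add: vec_eq_iff matrix_matrix_mult_def sum_subtractf right_diff_distrib)

lemma matrix_diff_rdistrib: "(A - B) ** C = A ** C - B ** (C :: 'a::ring_1 ^ 'm ^ 'n)"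
  by (simp add: vec_eq_iff matrix_matrix_mult_def sum_subtractf left_diff_distrib)

lemma matrix_scaleR_left: "(c *\<^sub>R A) ** B = c *\<^sub>R (A ** (B :: 'a::real_algebra_1 ^ 'm ^ 'n))"
  by (simp add: vec_eq_iff matrix_matrix_mult_def scaleR_sum_right)

lemma matrix_scaleR_right: "A ** (c *\<^sub>R B) = c *\<^sub>R (A ** (B :: 'a::real_algebra_1 ^ 'm ^ 'n))"
  by (simp add: vec_eq_iff matrix_matrix_mult_def scaleR_sum_right)

lemmas matrix_ring_simps = matrix_add_ldistrib matrix_add_rdistrib matrix_diff_ldistrib
  matrix_diff_rdistrib matrix_scaleR_left matrix_scaleR_right matrix_mul_assoc

lemma matrix_vector_mult_minus_left: "(- X) *v y = - (X *v (y :: real ^ 'm))"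
  by (simp add: vec_eq_iff matrix_vector_mult_def sum_negf)

lemma matrix_vector_mult_minus_right: "X *v (- y) = - (X *v (y :: real ^ 'm))"
  by (rule linear_neg[OF matrix_vector_mul_linear])

lemma matrix_mult_minus_left: "(- X) ** Y = - (X ** Y)" for X :: "real ^ 'm ^ 'k"
  by (simp add: vec_eq_iff matrix_matrix_mult_def sum_negf)

lemma matrix_mult_minus_right: "X ** (- Y) = - (X ** Y)" for X :: "real ^ 'm ^ 'k"
  by (simp add: vec_eq_iff matrix_matrix_mult_def sum_negf)

lemma transpose_add: "transpose (X + Y) = transpose X + transpose (Y :: 'a::semiring_1 ^ 'm ^ 'n)"
  by (simp add: transpose_def vec_eq_iff)

lemma transpose_zero: "transpose (0 :: 'a::semiring_1 ^ 'm ^ 'n) = 0"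
  by (simp add: transpose_def vec_eq_iff)

text \<open>The field is left open because the same bounds serve the complex iteration, where
  holomorphy is obtained, and its real restriction. The bound is submultiplicative only up to the
  factor \<open>CARD('m)\<close>, the origin of that factor in all later estimates.\<close>

definition entries_le :: "'a::real_normed_field ^ 'm ^ 'm \<Rightarrow> real \<Rightarrow> bool"
  where "entries_le X x \<longleftrightarrow> (\<forall>i j. norm (X $ i $ j) \<le> x)"

lemma entries_le_mult:
  fixes X Y :: "'a::real_normed_field ^ 'm ^ 'm"
  assumes "entries_le X x" "entries_le Y y"
  shows "entries_le (X ** Y) (real CARD('m) * x * y)"
  unfolding entries_le_def
proof (intro allI)
  fix i j
  have x: "0 \<le> x" using assms(1) norm_ge_zero order_trans unfolding entries_le_def by blast
  have "norm ((X ** Y) $ i $ j) \<le> (\<Sum>k\<in>UNIV. norm (X $ i $ k) * norm (Y $ k $ j))"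
    unfolding matrix_matrix_mult_def by (simp add: norm_mult[symmetric] norm_sum)
  also have "\<dots> \<le> (\<Sum>k\<in>(UNIV::'m set). x * y)"
    using assms x unfolding entries_le_def by (intro sum_mono mult_mono) auto
  finally show "norm ((X ** Y) $ i $ j) \<le> real CARD('m) * x * y" by simp
qed

lemma entries_le_add: "entries_le X x \<Longrightarrow> entries_le Y y \<Longrightarrow> entries_le (X + Y) (x + y)"
  unfolding entries_le_def by (auto intro!: norm_triangle_mono)

lemma entries_le_diff: "entries_le X x \<Longrightarrow> entries_le Y y \<Longrightarrow> entries_le (X - Y) (x + y)"
  unfolding entries_le_def by (auto intro!: norm_triangle_le_diff add_mono)

lemma entries_le_scaleR: "entries_le X x \<Longrightarrow> 0 \<le> c \<Longrightarrow> entries_le (c *\<^sub>R X) (c * x)"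
  unfolding entries_le_def by (auto intro: mult_left_mono)

lemma entries_le_mono: "entries_le X x \<Longrightarrow> x \<le> y \<Longrightarrow> entries_le X y"
  unfolding entries_le_def by (meson order_trans)

text \<open>The map whose fixed point \<open>Y\<close> turns an approximate idempotent \<open>N\<close> with
  \<open>E = N\<^sup>2 - N\<close> into the idempotent \<open>N + (1 - 2N) Y\<close>: since \<open>(1 - 2N)\<^sup>2 = 1 + 4E\<close>, idempotency
  amounts to \<open>E = (1 + 4E) (Y - Y\<^sup>2)\<close>.\<close>

definition idem_step :: "'a::real_normed_field ^ 'm ^ 'm \<Rightarrow> 'a ^ 'm ^ 'm \<Rightarrow> 'a ^ 'm ^ 'm"
  where "idem_step E Y = E - 4 *\<^sub>R (E ** Y) + (Y ** Y + 4 *\<^sub>R (E ** (Y ** Y)))"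

text \<open>Started at 0, every iterate is a polynomial in E without constant term; holomorphic
  dependence on a parameter and the algebraic properties of E are therefore inherited.\<close>

definition idem_iter :: "'a::real_normed_field ^ 'm ^ 'm \<Rightarrow> nat \<Rightarrow> 'a ^ 'm ^ 'm"
  where "idem_iter E n = (idem_step E ^^ n) 0"

lemma idem_iter_0: "idem_iter E 0 = 0"
  and idem_iter_Suc: "idem_iter E (Suc n) = idem_step E (idem_iter E n)"
  by (simp_all add: idem_iter_def)

text \<open>With s = CARD('m) * e, one step maps the ball of radius 2e into the ball of radius e (1
  + 12 s + 16 s^2). As s \<le> 1/32, the bracket is at most 1 + 28 s \<le> 2.\<close>

lemma entries_le_idem_iter:
  fixes E :: "'a::real_normed_field ^ 'm ^ 'm"
  assumes E: "entries_le E e" and e: "32 * (real CARD('m) * e) \<le> 1"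
  shows "entries_le (idem_iter E n) (2 * e)"
proof (induction n)
  case 0
  have "0 \<le> e" using E norm_ge_zero order_trans unfolding entries_le_def by blast
  then show ?case by (simp add: idem_iter_0 entries_le_def)
next
  case (Suc n)
  define K where "K = real CARD('m)"
  have e0: "0 \<le> e" using E norm_ge_zero order_trans unfolding entries_le_def by blast
  have K: "K \<ge> 0" and Ke: "32 * (K * e) \<le> 1" using e by (auto simp: K_def)
  have s0: "0 \<le> K * e" using K e0 by simp
  note Y = Suc.IH
  have YY: "entries_le (idem_iter E n ** idem_iter E n) (K * (2 * e) * (2 * e))"
    unfolding K_def by (rule entries_le_mult[OF Y Y])
  have "entries_le (idem_iter E (Suc n))
      (e + 4 * (K * e * (2 * e)) + (K * (2 * e) * (2 * e) + 4 * (K * e * (K * (2 * e) * (2 * e)))))"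
    unfolding idem_iter_Suc idem_step_def
    using entries_le_mult[OF E Y] entries_le_mult[OF E YY]
    by (intro entries_le_add entries_le_diff entries_le_scaleR E YY) (auto simp: K_def)
  moreover have "e + 4 * (K * e * (2 * e)) + (K * (2 * e) * (2 * e) + 4 * (K * e * (K * (2 * e) * (2 * e))))
    = e * (1 + 12 * (K * e) + 16 * ((K * e) * (K * e)))" by (simp add: algebra_simps)
  moreover have "(K * e) * (K * e) \<le> (K * e) * 1" using s0 Ke by (intro mult_left_mono) auto
  then have "e * (1 + 12 * (K * e) + 16 * ((K * e) * (K * e))) \<le> e * 2"
    using Ke by (intro mult_left_mono e0) linarith
  ultimately show ?case by (auto intro: entries_le_mono)
qed

text \<open>On the ball of radius 2e the step is a contraction with factor at most 8 s + 16 s^2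
  \<le> 1/2, where s = CARD('m) * e \<le> 1/32.\<close>

lemma entries_le_idem_iter_diff:
  fixes E :: "'a::real_normed_field ^ 'm ^ 'm"
  assumes E: "entries_le E e" and e: "32 * (real CARD('m) * e) \<le> 1"
  shows "entries_le (idem_iter E (Suc n) - idem_iter E n) (2 * e * (1/2) ^ n)"
proof (induction n)
  case 0
  have "0 \<le> e" using E norm_ge_zero order_trans unfolding entries_le_def by blast
  then show ?case using E
    by (auto simp: idem_iter_Suc idem_iter_0 idem_step_def intro: entries_le_mono)
next
  case (Suc n)
  define K where "K = real CARD('m)"
  define Y where "Y = idem_iter E n"
  define D where "D = idem_iter E (Suc n) - idem_iter E n"
  define d where "d = 2 * e * (1/2) ^ n"
  have D: "entries_le D d" using Suc.IH by (simp add: D_def d_def)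
  have e0: "0 \<le> e" using E norm_ge_zero order_trans unfolding entries_le_def by blast
  have K: "K \<ge> 0" and Ke: "32 * (K * e) \<le> 1" using e by (auto simp: K_def)
  have s0: "0 \<le> K * e" and d0: "0 \<le> d" using K e0 by (simp_all add: d_def)
  have Y: "entries_le Y (2 * e)" and Y': "entries_le (Y + D) (2 * e)"
    using entries_le_idem_iter[OF E e, of n] entries_le_idem_iter[OF E e, of "Suc n"]
    by (simp_all add: Y_def D_def)
  \<comment> \<open>W is (Y + D)^2 - Y^2, arranged so that every summand has a factor D.\<close>
  define W where "W = (Y + D) ** D + D ** Y"
  have W: "entries_le W (K * (2 * e) * d + K * d * (2 * e))"
    unfolding W_def K_def by (intro entries_le_add entries_le_mult D Y Y')
  have EW: "entries_le (E ** W) (K * e * (K * (2 * e) * d + K * d * (2 * e)))"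
    unfolding K_def by (rule entries_le_mult[OF E W[unfolded K_def]])
  have "idem_iter E (Suc (Suc n)) - idem_iter E (Suc n) = idem_step E (Y + D) - idem_step E Y"
    by (simp add: idem_iter_Suc Y_def D_def)
  also have "\<dots> = W + 4 *\<^sub>R (E ** W) - 4 *\<^sub>R (E ** D)"
    unfolding idem_step_def W_def by (simp add: matrix_ring_simps algebra_simps)
  also have "entries_le \<dots> ((K * (2 * e) * d + K * d * (2 * e)) +
      4 * (K * e * (K * (2 * e) * d + K * d * (2 * e))) + 4 * (K * e * d))"
    using entries_le_mult[OF E D]
    by (intro entries_le_add entries_le_diff entries_le_scaleR W EW) (auto simp: K_def)
  finally have "entries_le (idem_iter E (Suc (Suc n)) - idem_iter E (Suc n))
     (d * (8 * (K * e) + 16 * ((K * e) * (K * e))))" by (simp add: algebra_simps)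
  moreover have "(K * e) * (K * e) \<le> (K * e) * (1/32)" using s0 Ke by (intro mult_left_mono) auto
  then have "d * (8 * (K * e) + 16 * ((K * e) * (K * e))) \<le> d * (1/2)"
    using Ke by (intro mult_left_mono d0) linarith
  ultimately show ?case by (auto intro: entries_le_mono simp: d_def)
qed

text \<open>The limit is written as a telescoping series, starting from iterate 0 = 0, so that the
  geometric bound on the differences feeds the Weierstrass test.\<close>

lemma idem_iter_uniform_limit:
  fixes E :: "'b \<Rightarrow> 'a::{real_normed_field,banach} ^ 'm ^ 'm"
  assumes E: "\<And>z. z \<in> S \<Longrightarrow> entries_le (E z) e" and e: "32 * (real CARD('m) * e) \<le> 1"
  shows "uniform_limit S (\<lambda>n z. idem_iter (E z) n $ i $ j)
    (\<lambda>z. \<Sum>n. (idem_iter (E z) (Suc n) - idem_iter (E z) n) $ i $ j) sequentially"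
proof -
  have "uniform_limit S (\<lambda>n z. \<Sum>k<n. (idem_iter (E z) (Suc k) - idem_iter (E z) k) $ i $ j)
    (\<lambda>z. \<Sum>n. (idem_iter (E z) (Suc n) - idem_iter (E z) n) $ i $ j) sequentially"
  proof (rule Weierstrass_m_test)
    fix n z assume "z \<in> S"
    from entries_le_idem_iter_diff[OF E[OF this] e, of n]
    show "norm ((idem_iter (E z) (Suc n) - idem_iter (E z) n) $ i $ j) \<le> 2 * e * (1/2) ^ n"
      unfolding entries_le_def by blast
  next
    show "summable (\<lambda>n. 2 * e * (1/2::real) ^ n)" by (intro summable_mult summable_geometric) simp
  qed
  moreover have "(\<Sum>k<n. (idem_iter X (Suc k) - idem_iter X k) $ i $ j) = idem_iter X n $ i $ j"
    for X :: "'a ^ 'm ^ 'm" and n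
    by (induction n) (simp_all add: idem_iter_0)
  ultimately show ?thesis by simp
qed

lemma holomorphic_idem_iter:
  fixes E :: "complex \<Rightarrow> complex ^ 'm ^ 'm"
  assumes "\<And>i j. (\<lambda>z. E z $ i $ j) holomorphic_on S"
  shows "(\<lambda>z. idem_iter (E z) n $ i $ j) holomorphic_on S"
proof (induction n arbitrary: i j)
  case 0
  then show ?case by (simp add: idem_iter_0)
next
  case (Suc n)
  show ?case unfolding idem_iter_Suc idem_step_def matrix_matrix_mult_def
    by (simp add: scaleR_conv_of_real) (intro holomorphic_intros assms Suc)
qed

definition cmat :: "real ^ 'm ^ 'm \<Rightarrow> complex ^ 'm ^ 'm"
  where "cmat X = (\<chi> i j. of_real (X $ i $ j))"

lemma idem_iter_cmat: "idem_iter (cmat X) n = cmat (idem_iter X n)"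
  by (induction n) (auto simp: idem_iter_0 idem_iter_Suc idem_step_def cmat_def vec_eq_iff
      matrix_matrix_mult_def scaleR_conv_of_real)

text \<open>Uniform limits on a real interval can lose analyticity, so the entries of E are extended
  to a complex disc and the iteration is run there. The strict inequality between e' and e leaves
  room for a disc on which the bound e still holds.\<close>

lemma real_analytic_idempotent_correction:
  fixes E :: "real \<Rightarrow> real ^ 'm ^ 'm" and e :: real
  assumes E: "real_analytic_at E t0" and E0: "entries_le (E t0) e'" "e' < e"
    and e: "32 * (real CARD('m) * e) \<le> 1"
  obtains Y where "real_analytic_at Y t0"
    "\<forall>\<^sub>F t in nhds t0. (\<lambda>n. idem_iter (E t) n) \<longlonglongrightarrow> Y t"
    "\<forall>\<^sub>F t in nhds t0. entries_le (Y t) (2 * e)"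
proof -
  have "\<forall>i j. \<exists>F. F analytic_on {complex_of_real t0} \<and>
         (\<forall>\<^sub>F t in nhds t0. F (of_real t) = of_real (E t $ i $ j))"
    using E by (simp add: real_analytic_at_vec_iff flip: real_analytic_at_iff_complex)
  then obtain F where F: "\<And>i j. F i j analytic_on {complex_of_real t0}"
    and Fev: "\<And>i j. \<forall>\<^sub>F t in nhds t0. F i j (of_real t) = of_real (E t $ i $ j)"
    by metis
  define C where "C z = (\<chi> i j. F i j z)" for z
  have CE: "\<forall>\<^sub>F t in nhds t0. C (of_real t) = cmat (E t)"
  proof -
    have "\<forall>\<^sub>F t in nhds t0. \<forall>i j. F i j (of_real t) = of_real (E t $ i $ j)"
      using Fev by (intro eventually_all_finite) auto
    then show ?thesis by eventually_elim (simp add: C_def cmat_def vec_eq_iff)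
  qed
  have C0: "entries_le (C (of_real t0)) e'"
    using eventually_nhds_x_imp_x[OF CE] E0 by (simp add: entries_le_def cmat_def)
  have "\<exists>r>0. F i j holomorphic_on ball (of_real t0) r" for i j
    using F by (simp add: analytic_at_ball)
  then obtain rr where rr: "\<And>i j. rr i j > 0" "\<And>i j. F i j holomorphic_on ball (of_real t0) (rr i j)"
    by metis
  define r0 where "r0 = Min (range (\<lambda>(i, j). rr i j))"
  have r0: "r0 > 0" unfolding r0_def using rr by auto
  have Fhol: "F i j holomorphic_on ball (of_real t0) r0" for i j
  proof (rule holomorphic_on_subset[OF rr(2)])
    have "r0 \<le> rr i j" unfolding r0_def by (rule Min_le) (auto intro: rev_image_eqI[of "(i, j)"])
    then show "ball (complex_of_real t0) r0 \<subseteq> ball (of_real t0) (rr i j)" by (rule subset_ball)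
  qed
  have "\<forall>\<^sub>F z in nhds (of_real t0). norm (F i j z) < e" for i j
  proof -
    have "isCont (F i j) (of_real t0)"
      using holomorphic_on_imp_continuous_on[OF Fhol[of i j]] r0
      by (simp add: continuous_on_eq_continuous_at)
    then have "((\<lambda>z. norm (F i j z)) \<longlongrightarrow> norm (F i j (of_real t0))) (nhds (of_real t0))"
      by (intro tendsto_norm) (simp add: continuous_at tendsto_at_iff_tendsto_nhds)
    moreover have "norm (F i j (of_real t0)) < e"
      using C0 E0(2) unfolding entries_le_def C_def by (auto intro: le_less_trans)
    ultimately show ?thesis by (rule order_tendstoD(2))
  qed
  then have "\<forall>\<^sub>F z in nhds (complex_of_real t0). \<forall>i j. norm (F i j z) < e"
    by (intro eventually_all_finite)
  then obtain s where s: "s > 0" "\<And>z i j. dist z (of_real t0) < s \<Longrightarrow> norm (F i j z) < e"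
    by (auto simp: eventually_nhds_metric)
  define r where "r = min r0 s"
  define S where "S = ball (complex_of_real t0) r"
  have r: "r > 0" using r0 s by (simp add: r_def)
  have hol: "(\<lambda>z. C z $ i $ j) holomorphic_on S" for i j
    using Fhol[of i j] unfolding C_def S_def r_def by (auto intro: holomorphic_on_subset)
  have bd: "entries_le (C z) e" if "z \<in> S" for z
    using s(2)[of z] that unfolding entries_le_def C_def S_def r_def
    by (auto simp: dist_commute intro: less_imp_le)
  define G where "G i j z = (\<Sum>n. (idem_iter (C z) (Suc n) - idem_iter (C z) n) $ i $ j)" for i j z
  have ul: "uniform_limit S (\<lambda>n z. idem_iter (C z) n $ i $ j) (G i j) sequentially" for i j
    unfolding G_def by (rule idem_iter_uniform_limit[OF bd e])
  have Ghol: "G i j holomorphic_on S" for i j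
  proof (rule holomorphic_uniform_sequence)
    show "open S" by (simp add: S_def)
    show "(\<lambda>z. idem_iter (C z) n $ i $ j) holomorphic_on S" for n
      by (rule holomorphic_idem_iter[OF hol])
    fix z assume "z \<in> S"
    moreover have "open S" by (simp add: S_def)
    ultimately obtain d where "d > 0" "cball z d \<subseteq> S" using open_contains_cball by blast
    then show "\<exists>d>0. cball z d \<subseteq> S \<and>
        uniform_limit (cball z d) (\<lambda>n z. idem_iter (C z) n $ i $ j) (G i j) sequentially"
      using uniform_limit_on_subset[OF ul] by blast
  qed
  \<comment> \<open>The iterates of a real matrix are real, so near \<open>t0\<close> nothing is
    lost by taking real parts, and \<open>GR\<close> makes G the holomorphic extension of Y.\<close>
  define Y where "Y t = (\<chi> i j. Re (G i j (complex_of_real t)))" for t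
  have tS: "\<forall>\<^sub>F t in nhds t0. complex_of_real t \<in> S"
    using r by (auto simp: S_def eventually_nhds_metric dist_commute)
  have lim: "(\<lambda>n. cmat (idem_iter (E t) n) $ i $ j) \<longlonglongrightarrow> G i j (of_real t)"
    if "complex_of_real t \<in> S" "C (of_real t) = cmat (E t)" for t i j
    using tendsto_uniform_limitI[OF ul that(1), of i j] that(2) by (simp add: idem_iter_cmat)
  have limR: "(\<lambda>n. idem_iter (E t) n) \<longlonglongrightarrow> Y t"
    if "complex_of_real t \<in> S" "C (of_real t) = cmat (E t)" for t
  proof (intro vec_tendstoI)
    show "(\<lambda>n. idem_iter (E t) n $ i $ j) \<longlonglongrightarrow> Y t $ i $ j" for i j
      using tendsto_Re[OF lim[OF that, of i j]] by (simp add: Y_def cmat_def)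
  qed
  have GR: "G i j (of_real t) = of_real (Y t $ i $ j)"
    if "complex_of_real t \<in> S" "C (of_real t) = cmat (E t)" for t i j
  proof -
    have "(\<lambda>n. idem_iter (E t) n $ i $ j) \<longlonglongrightarrow> Y t $ i $ j"
      by (intro tendsto_vec_nth limR that)
    from tendsto_of_real[OF this, where 'a=complex] lim[OF that, of i j]
    show ?thesis by (simp add: cmat_def LIMSEQ_unique)
  qed
  show ?thesis
  proof
    show "real_analytic_at Y t0"
      unfolding real_analytic_at_vec_iff real_analytic_at_iff_complex
    proof (intro allI exI[of _ "G _ _"] conjI)
      fix i j
      show "G i j analytic_on {of_real t0}"
        using Ghol[of i j] r unfolding analytic_at_ball S_def by blast
      show "\<forall>\<^sub>F t in nhds t0. G i j (of_real t) = of_real (Y t $ i $ j)"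
        using tS CE by eventually_elim (rule GR)
    qed
    show "\<forall>\<^sub>F t in nhds t0. (\<lambda>n. idem_iter (E t) n) \<longlonglongrightarrow> Y t"
      using tS CE by eventually_elim (rule limR)
    show "\<forall>\<^sub>F t in nhds t0. entries_le (Y t) (2 * e)"
      using tS CE
    proof eventually_elim
      case (elim t)
      have "entries_le (E t) e" using bd[OF elim(1)] elim(2) by (simp add: entries_le_def cmat_def)
      then have *: "entries_le (idem_iter (E t) n) (2 * e)" for n
        using e by (rule entries_le_idem_iter)
      show ?case unfolding entries_le_def
      proof (intro allI)
        fix i j
        have "(\<lambda>n. norm (idem_iter (E t) n $ i $ j)) \<longlonglongrightarrow> norm (Y t $ i $ j)"
          by (intro tendsto_norm tendsto_vec_nth limR elim)
        then show "norm (Y t $ i $ j) \<le> 2 * e"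
          by (rule LIMSEQ_le_const2) (use * in \<open>auto simp: entries_le_def\<close>)
      qed
    qed
  qed
qed

section \<open>What the limit of the iteration inherits\<close>

lemma tendsto_matrix_mult:
  fixes f :: "'b \<Rightarrow> real ^ 'm ^ 'k" and g :: "'b \<Rightarrow> real ^ 'l ^ 'm"
  assumes "(f \<longlongrightarrow> a) F" "(g \<longlongrightarrow> b) F"
  shows "((\<lambda>x. f x ** g x) \<longlongrightarrow> a ** b) F"
  unfolding matrix_matrix_mult_def
  by (intro vec_tendstoI) (simp add: tendsto_sum tendsto_mult tendsto_vec_nth assms)

lemma idem_iter_limit_fixed:
  fixes E :: "real ^ 'm ^ 'm"
  assumes "(\<lambda>n. idem_iter E n) \<longlonglongrightarrow> Y"
  shows "idem_step E Y = Y"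
proof -
  have "(\<lambda>n. idem_step E (idem_iter E n)) \<longlonglongrightarrow> idem_step E Y"
    unfolding idem_step_def by (intro tendsto_intros tendsto_matrix_mult assms)
  moreover have "(\<lambda>n. idem_step E (idem_iter E n)) \<longlonglongrightarrow> Y"
    using LIMSEQ_Suc[OF assms] by (simp add: idem_iter_Suc)
  ultimately show ?thesis by (rule LIMSEQ_unique)
qed

text \<open>Subspaces are closed in finite dimension, so the limit stays where the iterates live.
  Closure is asked only for the two kinds of product occurring in a step, because selfadjoint
  matrices are not closed under arbitrary products.\<close>

lemma idem_iter_limit_in:
  fixes E :: "real ^ 'm ^ 'm"
  assumes "(\<lambda>n. idem_iter E n) \<longlonglongrightarrow> Y" and T: "subspace T" and E: "E \<in> T"
    and mult: "\<And>X. X \<in> T \<Longrightarrow> E ** X \<in> T" and sq: "\<And>X. X \<in> T \<Longrightarrow> X ** X \<in> T"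
  shows "Y \<in> T"
proof -
  have "idem_iter E n \<in> T" for n
  proof (induction n)
    case 0
    then show ?case by (simp add: idem_iter_0 subspace_0[OF T])
  next
    case (Suc n)
    then show ?case unfolding idem_iter_Suc idem_step_def
      by (intro subspace_add subspace_diff subspace_scale T E mult sq)
  qed
  then show ?thesis using closed_subspace[OF T] assms(1) closed_sequentially by blast
qed

text \<open>When N and Y commute, the idempotency defect of the candidate is exactly
  \<open>idem_step (N ** N - N) Y - Y\<close>, which a fixed point makes zero.\<close>

lemma idempotent_correction:
  fixes N Y :: "real ^ 'm ^ 'm"
  assumes Y: "idem_step (N ** N - N) Y = Y" and c: "N ** Y = Y ** N"
  shows "(N + (Y - 2 *\<^sub>R (N ** Y))) ** (N + (Y - 2 *\<^sub>R (N ** Y))) = N + (Y - 2 *\<^sub>R (N ** Y))"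
proof -
  have c': "X ** Y ** N = X ** N ** Y" for X by (metis c matrix_mul_assoc)
  have "(N + (Y - 2 *\<^sub>R (N ** Y))) ** (N + (Y - 2 *\<^sub>R (N ** Y))) - (N + (Y - 2 *\<^sub>R (N ** Y)))
    = idem_step (N ** N - N) Y - Y"
    unfolding idem_step_def
    by (simp only: matrix_ring_simps c[symmetric] c') (simp add: vec_eq_iff algebra_simps)
  then show ?thesis using Y by simp
qed

subsection \<open>Spectral scaling for self-adjoint matrices\<close>

definition mform :: "real ^ 'm ^ 'm \<Rightarrow> real ^ 'm \<Rightarrow> real ^ 'm \<Rightarrow> real"
  where "mform A x y = x \<bullet> (A *v y)"

lemma mform_simps:
  "mform A (x + y) z = mform A x z + mform A y z"
  "mform A (x - y) z = mform A x z - mform A y z"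
  "mform A (c *\<^sub>R x) z = c * mform A x z"
  "mform A (- x) z = - mform A x z"
  "mform A 0 z = 0"
  "mform A z (x + y) = mform A z x + mform A z y"
  "mform A z (x - y) = mform A z x - mform A z y"
  "mform A z (c *\<^sub>R x) = c * mform A z x"
  "mform A z (- x) = - mform A z x"
  "mform A z 0 = 0"
  by (simp_all add: mform_def inner_left_distrib inner_right_distrib inner_diff_left inner_diff_right
      matrix_vector_right_distrib matrix_vector_mult_diff_distrib matrix_vector_mult_scaleR
      linear_neg[OF matrix_vector_mul_linear])

lemma inner_matrix_transpose: "x \<bullet> (transpose X *v y) = (X *v x) \<bullet> (y :: real ^ 'm)"
  by (metis dot_lmul_matrix inner_commute transpose_matrix_vector)

lemma mform_commute: "transpose A = A \<Longrightarrow> mform A x y = mform A y x"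
  unfolding mform_def by (metis inner_commute inner_matrix_transpose)

lemma mform_pos: "pos_def_matrix A \<Longrightarrow> x \<noteq> 0 \<Longrightarrow> 0 < mform A x x"
  by (simp add: pos_def_matrix_def mform_def)

lemma mform_nonneg: "pos_def_matrix A \<Longrightarrow> 0 \<le> mform A x x"
  using mform_pos[of A x] by (cases "x = 0") (auto simp: mform_simps)

lemma mform_adjoint:
  assumes "transpose X ** A = A ** Y"
  shows "mform A (X *v x) y = mform A x (Y *v y)"
  unfolding mform_def
  by (metis assms inner_matrix_transpose matrix_vector_mul_assoc)

lemma mform_adjointI:
  assumes "\<And>x y. mform A (X *v x) y = mform A x (Y *v y)"
  shows "transpose X ** A = A ** Y"
proof -
  have "x \<bullet> ((transpose X ** A) *v y) = x \<bullet> ((A ** Y) *v y)" for x y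
    using assms[of x y] unfolding mform_def
    by (simp only: inner_matrix_transpose matrix_vector_mul_assoc[symmetric])
  then have "(transpose X ** A) *v y = (A ** Y) *v y" for y
    by (metis vector_eq_ldot)
  then show ?thesis by (simp add: matrix_eq)
qed

text \<open>\<open>P \<in> proj_algebra A B P\<close> says that \<open>P\<close> is an \<open>A\<close>-orthogonal projection commuting with \<open>B\<close>.\<close>

definition proj_algebra ::
  "real ^ 'm ^ 'm \<Rightarrow> real ^ 'm ^ 'm \<Rightarrow> real ^ 'm ^ 'm \<Rightarrow> (real ^ 'm ^ 'm) set"
  where "proj_algebra A B P = {X. X ** B = B ** X \<and> P ** X = X \<and> X ** P = X \<and>
    transpose X ** A = A ** X}"

lemma subspace_proj_algebra: "subspace (proj_algebra A B P)"
  unfolding subspace_def proj_algebra_def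
  by (auto simp: matrix_ring_simps transpose_add transpose_scalar transpose_zero)

text \<open>Transposition reverses the factors; their commutation is what keeps the product
  selfadjoint.\<close>

lemma proj_algebra_mult:
  assumes "X \<in> proj_algebra A B P" "Y \<in> proj_algebra A B P" "X ** Y = Y ** X"
  shows "X ** Y \<in> proj_algebra A B P"
proof -
  have X: "X ** B = B ** X" "P ** X = X" "X ** P = X" "transpose X ** A = A ** X"
    and Y: "Y ** B = B ** Y" "P ** Y = Y" "Y ** P = Y" "transpose Y ** A = A ** Y"
    using assms by (auto simp: proj_algebra_def)
  have "X ** Y ** B = B ** (X ** Y)" by (metis X(1) Y(1) matrix_mul_assoc)
  moreover have "P ** (X ** Y) = X ** Y" "X ** Y ** P = X ** Y"
    by (metis X(2) matrix_mul_assoc, metis Y(3) matrix_mul_assoc)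
  moreover have "transpose (X ** Y) ** A = A ** (X ** Y)"
    unfolding matrix_transpose_mul by (metis X(4) Y(4) assms(3) matrix_mul_assoc)
  ultimately show ?thesis by (simp add: proj_algebra_def)
qed

lemma proj_algebra_in_sub:
  assumes "Q \<in> proj_algebra A B P" "X \<in> proj_algebra A B Q"
  shows "X \<in> proj_algebra A B P"
  using assms unfolding proj_algebra_def mem_Collect_eq by (metis matrix_mul_assoc)

lemma proj_algebraD:
  assumes "X \<in> proj_algebra A B P"
  shows "X ** B = B ** X" "P ** X = X" "X ** P = X" "transpose X ** A = A ** X"
  using assms by (auto simp: proj_algebra_def)

lemma mform_selfadjoint_quadratic:
  assumes "transpose A = A" "transpose X ** A = A ** X"
  shows "mform A (x + y) (X *v (x + y)) = mform A x (X *v x) + mform A y (X *v y) + 2 * mform A x (X *v y)"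
proof -
  have "mform A y (X *v x) = mform A x (X *v y)"
    using mform_adjoint[OF assms(2), of y x] mform_commute[OF assms(1)] by metis
  then show ?thesis by (simp add: mform_simps matrix_vector_right_distrib)
qed

text \<open>A null vector of a semidefinite form minimises it, so moving from x in the direction y =
  C x cannot decrease the form; to first order it would, unless y = 0.\<close>

lemma mform_semidefinite_kernel:
  assumes A: "pos_def_matrix A" and C: "transpose C ** A = A ** C"
    and nn: "\<And>z. 0 \<le> mform A z (C *v z)" and x: "mform A x (C *v x) = 0"
  shows "C *v x = 0"
proof (rule ccontr)
  assume "C *v x \<noteq> 0"
  define y where "y = C *v x"
  define p where "p = mform A y y"
  define r where "r = mform A y (C *v y)"
  have p: "0 < p" using \<open>C *v x \<noteq> 0\<close> mform_pos[OF A] by (simp add: p_def y_def)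
  have r: "0 \<le> r" using nn by (simp add: r_def)
  have sA: "transpose A = A" using A by (simp add: pos_def_matrix_def)
  \<comment> \<open>The minimiser in s would be -p / r; the shifted denominator also covers r = 0.
    Since p = -s (r + 1), the value becomes -s^2 (r + 2) < 0.\<close>
  define s where "s = - p / (r + 1)"
  have "mform A x (C *v y) = p"
    using mform_adjoint[OF C, of x y] by (simp add: p_def y_def)
  then have "0 \<le> s\<^sup>2 * r + 2 * (s * p)"
    using nn[of "x + s *\<^sub>R y"] x unfolding mform_selfadjoint_quadratic[OF sA C]
    by (simp add: mform_simps matrix_vector_mult_scaleR r_def power2_eq_square mult.assoc)
  also have "s\<^sup>2 * r + 2 * (s * p) = s\<^sup>2 * (r - 2 * (r + 1))"
  proof -
    have p_eq: "p = - s * (r + 1)" using r by (simp add: s_def)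
    show ?thesis unfolding p_eq by (simp add: algebra_simps power2_eq_square)
  qed
  also have "\<dots> < 0" using p r by (intro mult_pos_neg) (auto simp: s_def)
  finally show False by simp
qed

text \<open>Since X = P X P with P selfadjoint, the form of X sees only P z, and estimates on the
  range of P extend to all vectors.\<close>

lemma mform_restrict_range:
  assumes P: "P \<in> proj_algebra A B P" and X: "X \<in> proj_algebra A B P"
  shows "mform A z (X *v z) = mform A (P *v z) (X *v (P *v z))"
  using mform_adjoint[OF proj_algebraD(4)[OF P]] proj_algebraD(2,3)[OF X]
  by (metis matrix_vector_mul_assoc)

text \<open>The extreme Rayleigh quotients of K on the range of P are its extreme eigenvalues there;
  the affine map sending them to 0 and 1 is the one sought. The vectors x and y are the
  corresponding eigenvectors.\<close>

lemma spectral_gap_scaling: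
  fixes A B P K :: "real ^ 'm ^ 'm"
  assumes A: "pos_def_matrix A" and P: "P \<in> proj_algebra A B P" and K: "K \<in> proj_algebra A B P"
    and w: "P *v w = w" "w \<noteq> 0" "mform A w (K *v w) = 0" and K0: "K \<noteq> 0"
  obtains s c x y where
    "\<And>z. 0 \<le> mform A z ((s *\<^sub>R (K - c *\<^sub>R P)) *v z)"
    "\<And>z. mform A z ((s *\<^sub>R (K - c *\<^sub>R P)) *v z) \<le> mform A z (P *v z)"
    "x \<noteq> 0" "P *v x = x" "(s *\<^sub>R (K - c *\<^sub>R P)) *v x = x"
    "y \<noteq> 0" "P *v y = y" "(s *\<^sub>R (K - c *\<^sub>R P)) *v y = 0"
proof -
  \<comment> \<open>The Euclidean sphere suffices for compactness, since q is invariant under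
    scaling.\<close>
  define S where "S = {x. P *v x = x} \<inter> sphere 0 1"
  define q where "q x = mform A x (K *v x) / mform A x x" for x
  have "closed {x. P *v x = x}"
    by (intro closed_Collect_eq continuous_intros)
  then have S: "compact S" unfolding S_def by (intro closed_Int_compact compact_sphere)
  have "(1 / norm w) *\<^sub>R w \<in> S" using w by (simp add: S_def matrix_vector_mult_scaleR)
  then have Sne: "S \<noteq> {}" by blast
  have q: "continuous_on S q" unfolding q_def
  proof (intro continuous_on_divide ballI)
    fix x assume "x \<in> S"
    then have "x \<noteq> 0" by (auto simp: S_def)
    then show "mform A x x \<noteq> 0" using mform_pos[OF A] by force
  qed (auto simp: mform_def matrix_vector_mul_assoc intro!: continuous_intros)
  obtain x where x: "x \<in> S" and xmax: "\<And>z. z \<in> S \<Longrightarrow> q z \<le> q x"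
    using continuous_attains_sup[OF S Sne q] by blast
  obtain y where y: "y \<in> S" and ymin: "\<And>z. z \<in> S \<Longrightarrow> q y \<le> q z"
    using continuous_attains_inf[OF S Sne q] by blast
  have bounds: "q y * mform A z z \<le> mform A z (K *v z)" "mform A z (K *v z) \<le> q x * mform A z z"
    if z: "P *v z = z" for z
  proof -
    have "q y * mform A z z \<le> mform A z (K *v z) \<and> mform A z (K *v z) \<le> q x * mform A z z"
    proof (cases "z = 0")
      case False
      define u where "u = (1 / norm z) *\<^sub>R z"
      have "u \<in> S" using z False by (simp add: S_def u_def matrix_vector_mult_scaleR)
      moreover have "q u = q z" using False
        by (simp add: q_def u_def mform_simps matrix_vector_mult_scaleR)
      ultimately have "q y \<le> q z" "q z \<le> q x" using xmax ymin by metis+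
      then show ?thesis using mform_pos[OF A False] by (simp add: q_def field_simps)
    qed (simp add: mform_simps)
    then show "q y * mform A z z \<le> mform A z (K *v z)" "mform A z (K *v z) \<le> q x * mform A z z" by auto
  qed
  \<comment> \<open>If the extremes agreed, the vector w would force their common value to be 0; the
    form of K would vanish identically, hence so would K.\<close>
  have "q y < q x"
  proof (rule ccontr)
    assume "\<not> q y < q x"
    then have eq: "q x = q y" using xmax[OF y] by linarith
    have all: "mform A z (K *v z) = q y * mform A z z" if "P *v z = z" for z
      using bounds[OF that] eq by simp
    have "q y = 0" using all[OF w(1)] w(3) mform_pos[OF A w(2)] by simp
    then have "mform A z (K *v z) = 0" for z
      unfolding mform_restrict_range[OF P K, of z]
      by (subst all) (auto simp: matrix_vector_mul_assoc proj_algebraD(2)[OF P])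
    then have "K *v z = 0" for z
      using mform_semidefinite_kernel[OF A proj_algebraD(4)[OF K]] by simp
    then have "K = 0" by (simp add: matrix_eq)
    then show False using K0 by simp
  qed
  define s where "s = 1 / (q x - q y)"
  define c where "c = q y"
  define M where "M = s *\<^sub>R (K - c *\<^sub>R P)"
  have s: "s > 0" using \<open>q y < q x\<close> by (simp add: s_def)
  have Mz: "M *v z = s *\<^sub>R (K *v z - c *\<^sub>R (P *v z))" for z
    by (simp add: M_def matrix_vector_mult_diff_rdistrib flip: scaleR_matrix_vector_assoc)
  have M: "M \<in> proj_algebra A B P" unfolding M_def
    by (intro subspace_scale subspace_diff subspace_proj_algebra P K)
  have PM: "P - M \<in> proj_algebra A B P"
    by (intro subspace_diff subspace_proj_algebra P M)
  have PP: "P *v (P *v z) = P *v z" for z using proj_algebraD(2)[OF P] by (simp add: matrix_vector_mul_assoc)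
  have M0: "0 \<le> mform A z (M *v z)" for z
    unfolding mform_restrict_range[OF P M, of z] using bounds(1)[OF PP, of z] s
    by (simp add: Mz PP mform_simps c_def)
  have sc: "s * (q x - c) = 1" using \<open>q y < q x\<close> by (simp add: s_def c_def)
  have M1: "0 \<le> mform A z ((P - M) *v z)" for z
  proof -
    have "s * (mform A (P *v z) (K *v (P *v z)) - c * mform A (P *v z) (P *v z))
      \<le> s * (q x * mform A (P *v z) (P *v z) - c * mform A (P *v z) (P *v z))"
      using bounds(2)[OF PP, of z] s by simp
    also have "\<dots> = (s * (q x - c)) * mform A (P *v z) (P *v z)" by (simp add: algebra_simps)
    finally show ?thesis
      unfolding mform_restrict_range[OF P PM, of z] sc
      by (simp add: matrix_vector_mult_diff_rdistrib Mz PP mform_simps)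
  qed
  have x': "x \<noteq> 0" "P *v x = x" and y': "y \<noteq> 0" "P *v y = y" using x y by (auto simp: S_def)
  have "mform A x (K *v x) = q x * mform A x x" using mform_pos[OF A x'(1)] by (simp add: q_def)
  then have "mform A x ((P - M) *v x) = mform A x x - (s * (q x - c)) * mform A x x"
    by (simp add: matrix_vector_mult_diff_rdistrib Mz x' mform_simps algebra_simps)
  \<comment> \<open>P - M is semidefinite and its form vanishes at the maximiser x, so x lies in its
    kernel; for the minimiser y the same is done with M.\<close>
  then have "(P - M) *v x = 0"
    by (intro mform_semidefinite_kernel[OF A proj_algebraD(4)[OF PM] M1]) (simp add: sc)
  then have Mx: "M *v x = x" by (simp add: matrix_vector_mult_diff_rdistrib x')
  have "mform A y (K *v y) = q y * mform A y y" using mform_pos[OF A y'(1)] by (simp add: q_def)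
  then have My: "M *v y = 0"
    by (intro mform_semidefinite_kernel[OF A proj_algebraD(4)[OF M] M0])
      (simp add: Mz y' mform_simps c_def)
  show ?thesis
  proof (rule that[of s c x y])
    show "mform A z ((s *\<^sub>R (K - c *\<^sub>R P)) *v z) \<le> mform A z (P *v z)" for z
      using M1[of z] by (simp add: matrix_vector_mult_diff_rdistrib mform_simps flip: M_def)
  qed (use M0 x' y' Mx My in \<open>simp_all flip: M_def\<close>)
qed

section \<open>Repeated squaring of a selfadjoint matrix with spectrum in [0,1]\<close>

definition iter_square :: "real ^ 'm ^ 'm \<Rightarrow> nat \<Rightarrow> real ^ 'm ^ 'm"
  where "iter_square M k = ((\<lambda>X. X ** X) ^^ k) M"

lemma iter_square_0: "iter_square M 0 = M"
  and iter_square_Suc: "iter_square M (Suc k) = iter_square M k ** iter_square M k"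
  by (simp_all add: iter_square_def)

lemma iter_square_in_proj_algebra:
  "M \<in> proj_algebra A B P \<Longrightarrow> iter_square M k \<in> proj_algebra A B P"
  by (induction k) (auto simp: iter_square_0 iter_square_Suc intro: proj_algebra_mult)

lemma real_analytic_at_iter_square:
  "real_analytic_at M t0 \<Longrightarrow> real_analytic_at (\<lambda>t. iter_square (M t) k) t0"
  by (induction k) (simp_all add: iter_square_0 iter_square_Suc real_analytic_at_matrix_matrix_mult)

text \<open>With C = P - N one has N - N^2 = N C N + C N C, a sum of two visibly semidefinite
  matrices.\<close>

lemma mform_square_le:
  assumes P: "P \<in> proj_algebra A B P" and N: "N \<in> proj_algebra A B P"
    and N0: "\<And>z. 0 \<le> mform A z (N *v z)" and N1: "\<And>z. mform A z (N *v z) \<le> mform A z (P *v z)"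
  shows "mform A z ((N ** N) *v z) \<le> mform A z (N *v z)"
proof -
  define C where "C = P - N"
  have C: "C \<in> proj_algebra A B P"
    unfolding C_def by (intro subspace_diff subspace_proj_algebra P N)
  have C0: "0 \<le> mform A z (C *v z)" for z
    using N1[of z] by (simp add: C_def matrix_vector_mult_diff_rdistrib mform_simps)
  have e: "N - N ** N = N ** C ** N + C ** N ** C"
  proof -
    have "N ** N ** P = N ** N" by (metis matrix_mul_assoc proj_algebraD(3)[OF N])
    then show ?thesis unfolding C_def using proj_algebraD(2,3)[OF N] proj_algebraD(2)[OF P]
      by (simp add: matrix_ring_simps)
  qed
  have "mform A z ((N ** C ** N) *v z) = mform A (N *v z) (C *v (N *v z))"
    using mform_adjoint[OF proj_algebraD(4)[OF N]] by (simp add: matrix_vector_mul_assoc matrix_mul_assoc)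
  moreover have "mform A z ((C ** N ** C) *v z) = mform A (C *v z) (N *v (C *v z))"
    using mform_adjoint[OF proj_algebraD(4)[OF C]] by (simp add: matrix_vector_mul_assoc matrix_mul_assoc)
  ultimately have "0 \<le> mform A z ((N - N ** N) *v z)"
    unfolding e using C0 N0 by (simp add: matrix_vector_mult_add_rdistrib mform_simps)
  then show ?thesis by (simp add: matrix_vector_mult_diff_rdistrib mform_simps)
qed

lemma iter_square_bounds:
  assumes A: "pos_def_matrix A" and P: "P \<in> proj_algebra A B P" and M: "M \<in> proj_algebra A B P"
    and M0: "\<And>z. 0 \<le> mform A z (M *v z)" and M1: "\<And>z. mform A z (M *v z) \<le> mform A z (P *v z)"
  shows "0 \<le> mform A z (iter_square M k *v z) \<and> mform A z (iter_square M k *v z) \<le> mform A z (P *v z)"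
proof (induction k arbitrary: z)
  case 0
  then show ?case using M0 M1 by (simp add: iter_square_0)
next
  case (Suc k)
  define N where "N = iter_square M k"
  have N: "N \<in> proj_algebra A B P" unfolding N_def by (rule iter_square_in_proj_algebra[OF M])
  have "mform A z ((N ** N) *v z) \<le> mform A z (N *v z)"
    using Suc.IH by (intro mform_square_le[OF P N]) (auto simp: N_def)
  moreover have "0 \<le> mform A z ((N ** N) *v z)"
    using mform_nonneg[OF A, of "N *v z"] mform_adjoint[OF proj_algebraD(4)[OF N]]
    by (simp add: matrix_vector_mul_assoc)
  ultimately show ?case using Suc.IH[of z] by (simp add: iter_square_Suc flip: N_def)
qed

lemma pos_def_matrix_surj:
  assumes "pos_def_matrix A"
  obtains x where "A *v x = y"
proof -
  have "inj ((*v) A)"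
    unfolding linear_injective_0[OF matrix_vector_mul_linear]
    using mform_pos[OF assms] by (force simp: mform_def)
  then obtain L where "L ** A = mat 1" by (metis matrix_left_invertible_injective)
  then have "A *v (L *v y) = y"
    by (simp add: matrix_vector_mul_assoc matrix_left_right_inverse1)
  then show ?thesis by (rule that)
qed

text \<open>Along repeated squares the idempotency defect of one term is the difference to the next.
  For each fixed vector the quadratic forms decrease and are bounded below, so these differences
  tend to 0; polarization passes from quadratic to bilinear forms. No eigenvalue below 1 has to be
  located.\<close>

lemma iter_square_almost_idempotent:
  fixes A :: "real ^ 'm ^ 'm"
  assumes A: "pos_def_matrix A" and P: "P \<in> proj_algebra A B P" and M: "M \<in> proj_algebra A B P"
    and M0: "\<And>z. 0 \<le> mform A z (M *v z)" and M1: "\<And>z. mform A z (M *v z) \<le> mform A z (P *v z)"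
    and e: "e > 0"
  obtains k where "entries_le (iter_square M k ** iter_square M k - iter_square M k) e"
proof -
  define N where "N = iter_square M"
  define E where "E k = N (Suc k) - N k" for k
  have sA: "transpose A = A" using A by (simp add: pos_def_matrix_def)
  have N: "N k \<in> proj_algebra A B P" for k unfolding N_def by (rule iter_square_in_proj_algebra[OF M])
  have E: "E k \<in> proj_algebra A B P" for k unfolding E_def by (intro subspace_diff subspace_proj_algebra N)
  have bd: "0 \<le> mform A z (N k *v z)" "mform A z (N k *v z) \<le> mform A z (P *v z)" for z k
    using iter_square_bounds[OF A P M M0 M1] by (auto simp: N_def)
  have diag: "(\<lambda>k. mform A z (E k *v z)) \<longlonglongrightarrow> 0" for z
  proof -
    have "decseq (\<lambda>k. mform A z (N k *v z))"
      using mform_square_le[OF P N bd] by (intro decseq_SucI) (simp add: N_def iter_square_Suc)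
    then obtain L where L: "(\<lambda>k. mform A z (N k *v z)) \<longlonglongrightarrow> L"
      using decseq_convergent[of _ 0] bd(1) by metis
    from tendsto_diff[OF LIMSEQ_Suc[OF L] L] show ?thesis
      by (simp add: E_def matrix_vector_mult_diff_rdistrib mform_simps)
  qed
  have off: "(\<lambda>k. mform A x (E k *v y)) \<longlonglongrightarrow> 0" for x y
  proof -
    have "(\<lambda>k. (mform A (x + y) (E k *v (x + y)) - mform A x (E k *v x) - mform A y (E k *v y)) / 2)
      \<longlonglongrightarrow> (0 - 0 - 0) / 2" by (intro tendsto_intros diag) auto
    then show ?thesis
      by (simp add: mform_selfadjoint_quadratic[OF sA proj_algebraD(4)[OF E]])
  qed
  have "(\<lambda>k. E k $ i $ j) \<longlonglongrightarrow> 0" for i j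
  proof -
    \<comment> \<open>Pairing with this x cancels A, so the form reads off a single matrix
      entry.\<close>
    obtain x where "A *v x = axis i 1" by (rule pos_def_matrix_surj[OF A])
    then have "mform A x (E k *v axis j 1) = E k $ i $ j" for k
      unfolding mform_def
      by (metis cart_eq_inner_axis inner_commute inner_matrix_transpose matrix_vector_mul_component sA)
    then show ?thesis using off[of x "axis j 1"] by simp
  qed
  then have "\<forall>\<^sub>F k in sequentially. norm (E k $ i $ j) < e" for i j
    using e tendsto_norm_zero order_tendstoD(2) by blast
  then have "\<forall>\<^sub>F k in sequentially. \<forall>i j. norm (E k $ i $ j) < e"
    by (intro eventually_all_finite)
  then obtain k where "\<And>i j. norm (E k $ i $ j) < e" by (auto simp: eventually_sequentially)
  then have "entries_le (E k) e" unfolding entries_le_def by (auto intro: less_imp_le)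
  then show ?thesis using that by (simp add: E_def N_def iter_square_Suc)
qed

subsection \<open>Rellich's reduction\<close>

text \<open>Restores at \<open>t0\<close> the identities that division by a power of t - t0 yields
  only away from it.\<close>

lemma eventually_eq_of_punctured:
  fixes f :: "real \<Rightarrow> 'a::t2_space"
  assumes "isCont f t0" "\<forall>\<^sub>F t in at t0. f t = c"
  shows "\<forall>\<^sub>F t in nhds t0. f t = c"
proof -
  have "(f \<longlongrightarrow> c) (at t0)"
    using assms(2) by (rule tendsto_eventually)
  then have "f t0 = c" using assms(1) unfolding isCont_def by (rule LIM_unique[rotated])
  with assms(2) show ?thesis by (simp add: eventually_nhds_conv_at)
qed

lemma eventually_nonzero_nhds:
  fixes f :: "real \<Rightarrow> 'a::{t2_space,zero}"
  assumes "isCont f t0" "f t0 \<noteq> 0"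
  shows "\<forall>\<^sub>F t in nhds t0. f t \<noteq> 0"
  using assms tendsto_imp_eventually_ne[of f "f t0" "at t0" 0]
  by (simp add: isCont_def eventually_nhds_conv_at)

text \<open>Compare both sides at a coordinate where the modulus of x is largest: Y contracts the
  maximum norm.\<close>

lemma entries_le_fixes_nothing:
  fixes Y :: "real ^ 'm ^ 'm"
  assumes "entries_le Y y" "real CARD('m) * y < 1" "Y *v x = x"
  shows "x = 0"
proof -
  define s where "s = Max (range (\<lambda>i. \<bar>x $ i\<bar>))"
  have s: "\<bar>x $ i\<bar> \<le> s" for i unfolding s_def by (rule Max_ge) auto
  have s0: "0 \<le> s" using s order_trans abs_ge_zero by blast
  have y0: "0 \<le> y" using assms(1) norm_ge_zero order_trans unfolding entries_le_def by blast
  have "s \<in> range (\<lambda>i. \<bar>x $ i\<bar>)" unfolding s_def by (rule Max_in) auto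
  then obtain i where i: "s = \<bar>x $ i\<bar>" by blast
  have "\<bar>(Y *v x) $ i\<bar> \<le> (\<Sum>j\<in>UNIV. \<bar>Y $ i $ j\<bar> * \<bar>x $ j\<bar>)"
    unfolding matrix_vector_mult_def by (simp add: abs_mult[symmetric])
  also have "\<dots> \<le> (\<Sum>j\<in>(UNIV::'m set). y * s)"
    using assms(1) s y0 by (intro sum_mono mult_mono) (auto simp: entries_le_def)
  finally have "s \<le> (real CARD('m) * y) * s" using i assms(3) by simp
  then have "s = 0" using assms(2) s0 by (smt (verit) mult_le_cancel_right1)
  then show ?thesis using s by (simp add: vec_eq_iff)
qed

lemma commuting_subspace: "subspace {X. X ** N = N ** (X :: real ^ 'm ^ 'm)}"
  unfolding subspace_def by (auto simp: matrix_ring_simps)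

lemma proj_algebra_self_refine:
  assumes "Q \<in> proj_algebra A B P" "Q ** Q = Q"
  shows "Q \<in> proj_algebra A B Q"
  using assms by (simp add: proj_algebra_def)

text \<open>One reduction step: the spectrum of \<open>K t0\<close> on the range of \<open>P t0\<close> is not a single point,
  and separating its largest from its smallest eigenvalue splits \<open>P\<close> analytically.\<close>

lemma projection_splitting:
  fixes A B P K :: "real \<Rightarrow> real ^ 'm ^ 'm"
  assumes A: "pos_def_matrix (A t0)"
    and P: "real_analytic_at P t0" "\<forall>\<^sub>F t in nhds t0. P t \<in> proj_algebra (A t) (B t) (P t)"
    and K: "real_analytic_at K t0" "\<forall>\<^sub>F t in nhds t0. K t \<in> proj_algebra (A t) (B t) (P t)"
    and w: "P t0 *v w = w" "w \<noteq> 0" "mform (A t0) w (K t0 *v w) = 0" and K0: "K t0 \<noteq> 0"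
  obtains Q x y where "real_analytic_at Q t0"
    "\<forall>\<^sub>F t in nhds t0. Q t \<in> proj_algebra (A t) (B t) (P t) \<and> Q t ** Q t = Q t"
    "Q t0 *v x \<noteq> 0" "P t0 *v y = y" "Q t0 *v y \<noteq> y"
proof -
  have P0: "P t0 \<in> proj_algebra (A t0) (B t0) (P t0)" and KP0: "K t0 \<in> proj_algebra (A t0) (B t0) (P t0)"
    using eventually_nhds_x_imp_x[OF P(2)] eventually_nhds_x_imp_x[OF K(2)] by auto
  obtain s c x y where sc:
    "\<And>z. 0 \<le> mform (A t0) z ((s *\<^sub>R (K t0 - c *\<^sub>R P t0)) *v z)"
    "\<And>z. mform (A t0) z ((s *\<^sub>R (K t0 - c *\<^sub>R P t0)) *v z) \<le> mform (A t0) z (P t0 *v z)"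
    and x: "x \<noteq> 0" "P t0 *v x = x" "(s *\<^sub>R (K t0 - c *\<^sub>R P t0)) *v x = x"
    and y: "y \<noteq> 0" "P t0 *v y = y" "(s *\<^sub>R (K t0 - c *\<^sub>R P t0)) *v y = 0"
    using spectral_gap_scaling[OF A P0 KP0 w K0] by metis
  define M where "M t = s *\<^sub>R (K t - c *\<^sub>R P t)" for t
  have Man: "real_analytic_at M t0" unfolding M_def by (intro real_analytic_intros K P)
  have Mev: "\<forall>\<^sub>F t in nhds t0. M t \<in> proj_algebra (A t) (B t) (P t)"
    using P(2) K(2) unfolding M_def
    by eventually_elim (intro subspace_scale subspace_diff subspace_proj_algebra)
  define e where "e = 1 / (32 * real CARD('m))"
  have e: "32 * (real CARD('m) * e) \<le> 1" "0 < e" "real CARD('m) * (2 * e) < 1"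
    by (auto simp: e_def)
  \<comment> \<open>Half of e at \<open>t0\<close> provides the strict inequality that lets the
    bound e hold in a neighbourhood.\<close>
  obtain k where k: "entries_le (iter_square (M t0) k ** iter_square (M t0) k - iter_square (M t0) k) (e / 2)"
    using iter_square_almost_idempotent[OF A P0 eventually_nhds_x_imp_x[OF Mev], of "e / 2"] sc e
    unfolding M_def by auto
  define N where "N t = iter_square (M t) k" for t
  define E where "E t = N t ** N t - N t" for t
  have Nan: "real_analytic_at N t0" unfolding N_def by (rule real_analytic_at_iter_square[OF Man])
  have Ean: "real_analytic_at E t0" unfolding E_def by (intro real_analytic_intros Nan)
  obtain Y where Y: "real_analytic_at Y t0"
    and Ylim: "\<forall>\<^sub>F t in nhds t0. (\<lambda>n. idem_iter (E t) n) \<longlonglongrightarrow> Y t"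
    and Ysmall: "\<forall>\<^sub>F t in nhds t0. entries_le (Y t) (2 * e)"
    using real_analytic_idempotent_correction[OF Ean _ _ e(1), of "e/2"] k e
    unfolding E_def N_def by auto
  define Q where "Q t = N t + (Y t - 2 *\<^sub>R (N t ** Y t))" for t
  have main: "Q t \<in> proj_algebra (A t) (B t) (P t) \<and> Q t ** Q t = Q t \<and> N t ** Y t = Y t ** N t"
    if M: "M t \<in> proj_algebra (A t) (B t) (P t)" and lim: "(\<lambda>n. idem_iter (E t) n) \<longlonglongrightarrow> Y t" for t
  proof -
    \<comment> \<open>Commutation with N is included because the correction formula needs N and Y to
      commute.\<close>
    define T where "T = proj_algebra (A t) (B t) (P t) \<inter> {X. X ** N t = N t ** X}"
    have N: "N t \<in> proj_algebra (A t) (B t) (P t)"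
      unfolding N_def by (rule iter_square_in_proj_algebra[OF M])
    have NN: "N t ** N t \<in> proj_algebra (A t) (B t) (P t)" by (intro proj_algebra_mult N refl)
    have E: "E t \<in> T" unfolding T_def E_def
      by (auto intro!: subspace_diff subspace_proj_algebra N NN) (simp add: matrix_ring_simps)
    have "Y t \<in> T"
    proof (rule idem_iter_limit_in[OF lim _ E])
      show "subspace T" unfolding T_def
        by (intro subspace_inter subspace_proj_algebra commuting_subspace)
      fix X assume X: "X \<in> T"
      then have XN: "X ** N t = N t ** X" by (simp add: T_def)
      then have XN': "Z ** X ** N t = Z ** N t ** X" for Z by (metis matrix_mul_assoc)
      have "E t ** X = X ** E t" unfolding E_def
        by (simp add: matrix_ring_simps XN XN')
      then show "E t ** X \<in> T" using X E XN' unfolding T_def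
        by (auto intro!: proj_algebra_mult) (simp add: E_def matrix_ring_simps)
      have "X ** X ** N t = N t ** (X ** X)" by (metis XN matrix_mul_assoc)
      then show "X ** X \<in> T" using X unfolding T_def
        by (auto intro!: proj_algebra_mult)
    qed
    then have Yp: "Y t \<in> proj_algebra (A t) (B t) (P t)" and YN: "N t ** Y t = Y t ** N t"
      by (auto simp: T_def)
    have "Q t \<in> proj_algebra (A t) (B t) (P t)" unfolding Q_def
      by (intro subspace_scale subspace_diff subspace_add subspace_proj_algebra N Yp proj_algebra_mult YN)
    moreover have "Q t ** Q t = Q t" unfolding Q_def
      by (rule idempotent_correction[OF _ YN]) (use idem_iter_limit_fixed[OF lim] in \<open>simp add: E_def\<close>)
    ultimately show ?thesis using YN by blast
  qed
  have M0: "M t0 \<in> proj_algebra (A t0) (B t0) (P t0)" using eventually_nhds_x_imp_x[OF Mev] .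
  have YN0: "N t0 ** Y t0 = Y t0 ** N t0" using main[OF M0] eventually_nhds_x_imp_x[OF Ylim] by blast
  have Y0: "entries_le (Y t0) (2 * e)" using eventually_nhds_x_imp_x[OF Ysmall] .
  have "iter_square (M t0) j *v x = x" for j
    by (induction j) (use x in \<open>simp_all add: iter_square_0 iter_square_Suc M_def flip: matrix_vector_mul_assoc\<close>)
  then have Nx: "N t0 *v x = x" by (simp add: N_def)
  have "iter_square (M t0) j *v y = 0" for j
    by (induction j) (use y in \<open>simp_all add: iter_square_0 iter_square_Suc M_def flip: matrix_vector_mul_assoc\<close>)
  then have Ny: "N t0 *v y = 0" by (simp add: N_def)
  have Qz: "Q t0 *v z = N t0 *v z + (Y t0 *v z - 2 *\<^sub>R (Y t0 *v (N t0 *v z)))" for z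
    unfolding Q_def YN0 by (simp add: matrix_vector_mult_add_rdistrib matrix_vector_mult_diff_rdistrib
        matrix_vector_mul_assoc flip: scaleR_matrix_vector_assoc)
  show ?thesis
  proof
    show "real_analytic_at Q t0" unfolding Q_def by (intro real_analytic_intros Nan Y)
    show "\<forall>\<^sub>F t in nhds t0. Q t \<in> proj_algebra (A t) (B t) (P t) \<and> Q t ** Q t = Q t"
      using Mev Ylim by eventually_elim (use main in blast)
    \<comment> \<open>As N fixes x and kills y, Q x = x - Y x and Q y = Y y at \<open>t0\<close>.
      Either failure would make Y fix a nonzero vector.\<close>
    show "Q t0 *v x \<noteq> 0"
    proof
      assume "Q t0 *v x = 0"
      then have "Y t0 *v x = x" unfolding Qz Nx by (simp add: scaleR_2)
      then show False using entries_le_fixes_nothing[OF Y0 e(3)] x by blast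
    qed
    show "P t0 *v y = y" by fact
    show "Q t0 *v y \<noteq> y"
      using entries_le_fixes_nothing[OF Y0 e(3)] y by (auto simp: Qz Ny)
  qed
qed

text \<open>Induction on the rank of P at \<open>t0\<close>. When the deviation K from a scalar does
  not vanish near \<open>t0\<close>, its leading coefficient at \<open>t0\<close> is nonzero and has
  w as a null vector of its form, which is exactly what a splitting requires.\<close>

lemma projection_with_scalar_square:
  fixes A B P :: "real \<Rightarrow> real ^ 'm ^ 'm"
  assumes A: "real_analytic_at A t0" "\<forall>\<^sub>F t in nhds t0. pos_def_matrix (A t)"
    and B: "real_analytic_at B t0" "\<forall>\<^sub>F t in nhds t0. transpose (B t) ** A t = A t ** (- B t)"
    and P: "real_analytic_at P t0" "\<forall>\<^sub>F t in nhds t0. P t \<in> proj_algebra (A t) (B t) (P t)"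
    and P0: "P t0 \<noteq> 0"
  shows "\<exists>Q a. real_analytic_at Q t0 \<and> real_analytic_at a t0 \<and> Q t0 \<noteq> 0 \<and>
    (\<forall>\<^sub>F t in nhds t0. Q t \<in> proj_algebra (A t) (B t) (P t) \<and> Q t ** Q t = Q t \<and>
       B t ** B t ** Q t = a t *\<^sub>R Q t)"
  using P P0
proof (induction "dim (range ((*v) (P t0)))" arbitrary: P rule: less_induct)
  case less
  note P = less.prems
  have Pt0: "P t0 \<in> proj_algebra (A t0) (B t0) (P t0)" using eventually_nhds_x_imp_x[OF P(2)] .
  have A0: "pos_def_matrix (A t0)" using eventually_nhds_x_imp_x[OF A(2)] .
  obtain w0 where "P t0 *v w0 \<noteq> 0" using P(3) by (auto simp: matrix_eq)
  define w where "w = P t0 *v w0"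
  have w: "w \<noteq> 0" "P t0 *v w = w"
    using \<open>P t0 *v w0 \<noteq> 0\<close> proj_algebraD(2)[OF Pt0] by (auto simp: w_def matrix_vector_mul_assoc)
  \<comment> \<open>The test vector is P(t) w, so that it stays in the range of P(t); at
    \<open>t0\<close> it is w itself, and the denominator is nonzero.\<close>
  define a where "a t = mform (A t) (P t *v w) (B t *v (B t *v (P t *v w))) / mform (A t) (P t *v w) (P t *v w)" for t
  define K where "K t = B t ** B t ** P t - a t *\<^sub>R P t" for t
  have den: "mform (A t0) (P t0 *v w) (P t0 *v w) \<noteq> 0" using mform_pos[OF A0 w(1)] w(2) by simp
  have aan: "real_analytic_at a t0" unfolding a_def using den unfolding mform_def
    by (intro real_analytic_intros A B P) auto
  have Kan: "real_analytic_at K t0" unfolding K_def by (intro real_analytic_intros A B P aan)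
  have Kev: "\<forall>\<^sub>F t in nhds t0. K t \<in> proj_algebra (A t) (B t) (P t)"
    using P(2) B(2)
  proof eventually_elim
    case (elim t)
    note p = proj_algebraD[OF elim(1)]
    have BBP: "B t ** B t ** P t = P t ** B t ** B t" by (metis p(1) matrix_mul_assoc)
    \<comment> \<open>Two sign changes from the skew B cancel.\<close>
    have "transpose (B t ** B t ** P t) ** A t = A t ** (B t ** B t ** P t)"
    proof (rule mform_adjointI)
      fix x y
      have bb: "mform (A t) (B t *v x) y = - mform (A t) x (B t *v y)" for x y
        using mform_adjoint[OF elim(2), of x y] by (simp add: mform_simps matrix_vector_mult_minus_left)
      have "(B t ** B t ** P t) *v x = B t *v (B t *v (P t *v x))"
        by (simp only: matrix_vector_mul_assoc matrix_mul_assoc)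
      moreover have "(B t ** B t ** P t) *v y = P t *v (B t *v (B t *v y))"
        by (simp only: BBP matrix_vector_mul_assoc matrix_mul_assoc)
      ultimately show "mform (A t) ((B t ** B t ** P t) *v x) y = mform (A t) x ((B t ** B t ** P t) *v y)"
        by (simp only: bb mform_adjoint[OF p(4)] minus_minus)
    qed
    moreover have "B t ** B t ** P t ** B t = B t ** (B t ** B t ** P t)" by (metis p(1) matrix_mul_assoc)
    moreover have "P t ** (B t ** B t ** P t) = B t ** B t ** P t" by (metis BBP p(2) matrix_mul_assoc)
    moreover have "B t ** B t ** P t ** P t = B t ** B t ** P t" by (metis p(2) matrix_mul_assoc)
    ultimately have "B t ** B t ** P t \<in> proj_algebra (A t) (B t) (P t)" by (simp add: proj_algebra_def)
    then show ?case unfolding K_def by (intro subspace_scale subspace_diff subspace_proj_algebra elim)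
  qed
  have wev: "\<forall>\<^sub>F t in nhds t0. mform (A t) (P t *v w) (K t *v (P t *v w)) = 0"
  proof -
    have "isCont (\<lambda>t. mform (A t) (P t *v w) (P t *v w)) t0" unfolding mform_def
      by (intro isCont_real_analytic_at_real real_analytic_intros A P)
    then have "\<forall>\<^sub>F t in nhds t0. mform (A t) (P t *v w) (P t *v w) \<noteq> 0"
      using den by (rule eventually_nonzero_nhds)
    then show ?thesis using P(2)
    proof eventually_elim
      case (elim t)
      have "P t *v (P t *v w) = P t *v w" using proj_algebraD(2)[OF elim(2)] by (simp add: matrix_vector_mul_assoc)
      then show ?case using elim(1)
        by (simp add: K_def a_def mform_simps matrix_vector_mult_diff_rdistrib
          flip: matrix_vector_mul_assoc scaleR_matrix_vector_assoc)
    qed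
  qed
  from Kan show ?case
  proof (cases rule: real_analytic_at_factor)
    case 1
    then have "\<forall>\<^sub>F t in nhds t0. P t \<in> proj_algebra (A t) (B t) (P t) \<and> P t ** P t = P t \<and>
       B t ** B t ** P t = a t *\<^sub>R P t"
      using P(2) by eventually_elim (auto simp: K_def proj_algebra_def)
    then show ?thesis using P aan by blast
  next
    case (2 k K1)
    have ne: "\<forall>\<^sub>F t in at t0. t \<noteq> t0" by (auto simp: eventually_at_filter)
    have at: "\<forall>\<^sub>F t in at t0. F t" if "\<forall>\<^sub>F t in nhds t0. F t" for F
      using that by (simp add: eventually_nhds_conv_at)
    have K1eq: "\<forall>\<^sub>F t in at t0. K1 t = inverse ((t - t0) ^ k) *\<^sub>R K t"
      using ne at[OF 2(3)] by eventually_elim simp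
    have K1at: "\<forall>\<^sub>F t in at t0. K1 t \<in> proj_algebra (A t) (B t) (P t)"
      using K1eq at[OF Kev]
      by eventually_elim (auto intro: subspace_scale[OF subspace_proj_algebra])
    have tr: "real_analytic_at (\<lambda>t. transpose (K1 t)) t0"
      using 2(1) by (simp add: real_analytic_at_vec_iff transpose_def)
    \<comment> \<open>Each equation defining \<open>proj_algebra\<close> is written as a difference
      that is continuous at \<open>t0\<close> and zero away from it.\<close>
    note cont = isCont_real_analytic_at_matrix real_analytic_intros A(1) B(1) P(1) 2(1) tr
    have "\<forall>\<^sub>F t in nhds t0. K1 t ** B t - B t ** K1 t = 0"
      by (rule eventually_eq_of_punctured, intro cont, use K1at in eventually_elim) (simp add: proj_algebra_def)
    moreover have "\<forall>\<^sub>F t in nhds t0. P t ** K1 t - K1 t = 0"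
      by (rule eventually_eq_of_punctured, intro cont, use K1at in eventually_elim) (simp add: proj_algebra_def)
    moreover have "\<forall>\<^sub>F t in nhds t0. K1 t ** P t - K1 t = 0"
      by (rule eventually_eq_of_punctured, intro cont, use K1at in eventually_elim) (simp add: proj_algebra_def)
    moreover have "\<forall>\<^sub>F t in nhds t0. transpose (K1 t) ** A t - A t ** K1 t = 0"
      by (rule eventually_eq_of_punctured, intro cont, use K1at in eventually_elim) (simp add: proj_algebra_def)
    ultimately have K1ev: "\<forall>\<^sub>F t in nhds t0. K1 t \<in> proj_algebra (A t) (B t) (P t)"
      by eventually_elim (simp add: proj_algebra_def)
    have "\<forall>\<^sub>F t in nhds t0. mform (A t) (P t *v w) (K1 t *v (P t *v w)) = 0"
    proof (rule eventually_eq_of_punctured)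
      show "isCont (\<lambda>t. mform (A t) (P t *v w) (K1 t *v (P t *v w))) t0" unfolding mform_def
        by (intro isCont_real_analytic_at_real real_analytic_intros A P 2)
      show "\<forall>\<^sub>F t in at t0. mform (A t) (P t *v w) (K1 t *v (P t *v w)) = 0"
        using K1eq at[OF wev] by eventually_elim (simp add: mform_simps flip: scaleR_matrix_vector_assoc)
    qed
    from eventually_nhds_x_imp_x[OF this] have wK: "mform (A t0) w (K1 t0 *v w) = 0" by (simp add: w)
    obtain Q x y where Q: "real_analytic_at Q t0"
      "\<forall>\<^sub>F t in nhds t0. Q t \<in> proj_algebra (A t) (B t) (P t) \<and> Q t ** Q t = Q t"
      and x: "Q t0 *v x \<noteq> 0" and y: "P t0 *v y = y" "Q t0 *v y \<noteq> y"
      by (rule projection_splitting[OF A0 P(1,2) 2(1) K1ev w(2,1) wK 2(2)])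
    have QP0: "Q t0 \<in> proj_algebra (A t0) (B t0) (P t0)" "Q t0 ** Q t0 = Q t0"
      using eventually_nhds_x_imp_x[OF Q(2)] by auto
    have "range ((*v) (Q t0)) \<subset> range ((*v) (P t0))"
    proof
      show "range ((*v) (Q t0)) \<subseteq> range ((*v) (P t0))"
        using proj_algebraD(2)[OF QP0(1)] by (metis image_subsetI matrix_vector_mul_assoc rangeI)
      \<comment> \<open>The range of an idempotent consists of its fixed vectors. So y witnesses the
        strict drop of rank, while x keeps Q nonzero for the induction.\<close>
      have "y \<notin> range ((*v) (Q t0))"
        using y(2) QP0(2) by (auto simp: matrix_vector_mul_assoc)
      moreover have "y \<in> range ((*v) (P t0))" using y(1) by (metis rangeI)
      ultimately show "range ((*v) (Q t0)) \<noteq> range ((*v) (P t0))" by blast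
    qed
    moreover have "subspace (range ((*v) (Q t0)))" "subspace (range ((*v) (P t0)))"
      by (intro linear_subspace_image subspace_UNIV matrix_vector_mul_linear)+
    ultimately have "dim (range ((*v) (Q t0))) < dim (range ((*v) (P t0)))"
      using dim_psubset span_eq_iff by metis
    moreover have "\<forall>\<^sub>F t in nhds t0. Q t \<in> proj_algebra (A t) (B t) (Q t)"
      using Q(2) by eventually_elim (use proj_algebra_self_refine in blast)
    moreover have "Q t0 \<noteq> 0" using x by auto
    ultimately obtain R b where R: "real_analytic_at R t0" "real_analytic_at b t0" "R t0 \<noteq> 0"
      "\<forall>\<^sub>F t in nhds t0. R t \<in> proj_algebra (A t) (B t) (Q t) \<and> R t ** R t = R t \<and>
         B t ** B t ** R t = b t *\<^sub>R R t"
      using less.hyps[of Q] Q(1) by blast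
    have "\<forall>\<^sub>F t in nhds t0. R t \<in> proj_algebra (A t) (B t) (P t) \<and> R t ** R t = R t \<and>
         B t ** B t ** R t = b t *\<^sub>R R t"
      using R(4) Q(2) by eventually_elim (use proj_algebra_in_sub in blast)
    then show ?thesis using R by blast
  qed
qed

subsection \<open>Analytic eigenbases of a skew family\<close>

lemma mform_skew:
  assumes "transpose B ** A = A ** (- B)"
  shows "mform A (B *v x) y = - mform A x (B *v y)"
  using mform_adjoint[OF assms, of x y] by (simp add: mform_simps matrix_vector_mult_minus_left)

text \<open>The normalisation \<open>mform A u u = d\<close>, not 1, is the symplectic one: A u = d
  J v turns it into \<langle>u, J v\<rangle> = 1.\<close>

lemma analytic_eigenpair:
  fixes A B P :: "real \<Rightarrow> real ^ 'm ^ 'm"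
  assumes A: "real_analytic_at A t0" "\<forall>\<^sub>F t in nhds t0. pos_def_matrix (A t)"
    and B: "real_analytic_at B t0" "\<forall>\<^sub>F t in nhds t0. transpose (B t) ** A t = A t ** (- B t)"
    and inj: "inj ((*v) (B t0))"
    and P: "real_analytic_at P t0" "\<forall>\<^sub>F t in nhds t0. P t \<in> proj_algebra (A t) (B t) (P t)"
    and P0: "P t0 \<noteq> 0"
  obtains d u v where "real_analytic_at d t0" "real_analytic_at u t0" "real_analytic_at v t0"
    "\<forall>\<^sub>F t in nhds t0. 0 < d t \<and> B t *v u t = - d t *\<^sub>R v t \<and> B t *v v t = d t *\<^sub>R u t \<and>
       P t *v u t = u t \<and> P t *v v t = v t \<and> mform (A t) (u t) (u t) = d t"
proof -
  obtain Q a where Q: "real_analytic_at Q t0" "Q t0 \<noteq> 0" and a: "real_analytic_at a t0"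
    and ev: "\<forall>\<^sub>F t in nhds t0. Q t \<in> proj_algebra (A t) (B t) (P t) \<and> Q t ** Q t = Q t \<and>
       B t ** B t ** Q t = a t *\<^sub>R Q t"
    using projection_with_scalar_square[OF A B P P0] by blast
  obtain w0 where w0: "Q t0 *v w0 \<noteq> 0" using Q(2) by (auto simp: matrix_eq)
  define w where "w t = Q t *v w0" for t
  define n where "n t = mform (A t) (w t) (w t)" for t
  have wan: "real_analytic_at w t0" unfolding w_def by (intro real_analytic_intros Q)
  have nan: "real_analytic_at n t0" unfolding n_def mform_def by (intro real_analytic_intros A wan)
  have BBw: "\<forall>\<^sub>F t in nhds t0. B t *v (B t *v w t) = a t *\<^sub>R w t"
    using ev by eventually_elim
      (simp add: w_def matrix_vector_mul_assoc matrix_mul_assoc scaleR_matrix_vector_assoc)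
  have A0: "pos_def_matrix (A t0)" using eventually_nhds_x_imp_x[OF A(2)] .
  have n0: "0 < n t0" using mform_pos[OF A0 w0] by (simp add: n_def w_def)
  \<comment> \<open>Skewness makes the form of B^2 minus a squared A-norm, nonzero by injectivity.
    Hence a is negative at \<open>t0\<close>, and sqrt (- a) is analytic.\<close>
  have "a t0 * n t0 = - mform (A t0) (B t0 *v w t0) (B t0 *v w t0)"
    using eventually_nhds_x_imp_x[OF BBw] mform_skew[OF eventually_nhds_x_imp_x[OF B(2)], of "w t0" "B t0 *v w t0"]
    by (simp add: n_def mform_simps)
  also have "\<dots> < 0"
  proof -
    have "B t0 *v w t0 \<noteq> 0" using inj w0 by (metis injD matrix_vector_mult_0_right w_def)
    then show ?thesis using mform_pos[OF A0] by simp
  qed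
  finally have a0: "a t0 < 0" using n0 by (simp add: mult_less_0_iff)
  define d where "d t = sqrt (- a t)" for t
  have d0: "d t0 > 0" using a0 by (simp add: d_def)
  define u where "u t = sqrt (d t / n t) *\<^sub>R w t" for t
  define v where "v t = (- 1 / d t) *\<^sub>R (B t *v u t)" for t
  have dan: "real_analytic_at d t0" unfolding d_def using a0 by (intro real_analytic_intros a) auto
  have uan: "real_analytic_at u t0" unfolding u_def using n0 d0
    by (intro real_analytic_intros dan nan wan) auto
  have van: "real_analytic_at v t0" unfolding v_def using d0
    by (intro real_analytic_intros dan uan B) auto
  have pos: "\<forall>\<^sub>F t in nhds t0. f t > 0" if "real_analytic_at f t0" "f t0 > 0" for f :: "real \<Rightarrow> real"
    using isCont_real_analytic_at_real[OF that(1)] that(2) order_tendstoD(1)[of f "f t0" "nhds t0" 0]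
    by (simp add: continuous_at tendsto_at_iff_tendsto_nhds)
  have npos: "\<forall>\<^sub>F t in nhds t0. n t > 0" by (rule pos[OF nan n0])
  have apos: "\<forall>\<^sub>F t in nhds t0. - a t > 0"
    using a0 by (intro pos real_analytic_intros a) auto
  show ?thesis
  proof (rule that[OF dan uan van])
    show "\<forall>\<^sub>F t in nhds t0. 0 < d t \<and> B t *v u t = - d t *\<^sub>R v t \<and> B t *v v t = d t *\<^sub>R u t \<and>
       P t *v u t = u t \<and> P t *v v t = v t \<and> mform (A t) (u t) (u t) = d t"
      using npos apos ev P(2) BBw
    proof eventually_elim
      case (elim t)
      have d: "d t > 0" "d t * d t = - a t" using elim(2) by (simp_all add: d_def)
      have BBu: "B t *v (B t *v u t) = a t *\<^sub>R u t"
        using elim(5) by (simp add: u_def matrix_vector_mult_scaleR)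
      have PQ: "P t ** Q t = Q t" using elim(3) by (simp add: proj_algebra_def)
      then have Pu: "P t *v u t = u t"
        by (simp add: u_def w_def matrix_vector_mult_scaleR matrix_vector_mul_assoc)
      have "P t *v (B t *v u t) = B t *v (P t *v u t)"
        using elim(4) by (simp add: proj_algebra_def matrix_vector_mul_assoc)
      then have Pv: "P t *v v t = v t" by (simp add: v_def matrix_vector_mult_minus_right matrix_vector_mult_scaleR Pu)
      have "mform (A t) (u t) (u t) = (sqrt (d t / n t) * sqrt (d t / n t)) * n t"
        by (simp add: u_def mform_simps n_def mult.assoc del: real_sqrt_mult_self)
      also have "\<dots> = d t" using elim(1) d(1) by simp
      finally have uu: "mform (A t) (u t) (u t) = d t" .
      have ad: "a t = - d t * d t" using d by simp
      have "B t *v v t = d t *\<^sub>R u t" by (simp add: v_def matrix_vector_mult_minus_right matrix_vector_mult_scaleR BBu ad)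
      then show ?case using d Pu Pv uu by (simp add: v_def)
    qed
  qed
qed

section \<open>Removing an eigenvector pair from a projection\<close>

definition outer :: "real ^ 'm \<Rightarrow> real ^ 'm \<Rightarrow> real ^ 'm ^ 'm"
  where "outer x y = (\<chi> i j. x $ i * y $ j)"

lemma outer_mult_vector: "outer x y *v z = (y \<bullet> z) *\<^sub>R x"
  by (simp add: outer_def matrix_vector_mult_def vec_eq_iff inner_vec_def sum_distrib_left
      sum_distrib_right mult_ac)

lemma real_analytic_at_outer:
  "real_analytic_at x t0 \<Longrightarrow> real_analytic_at y t0 \<Longrightarrow> real_analytic_at (\<lambda>t. outer (x t) (y t)) t0"
  by (simp add: real_analytic_at_vec_iff outer_def real_analytic_at_mult)

text \<open>The subtracted term is the A-orthogonal projection onto the plane of u and v when these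
  are A-orthogonal; the factor 1/d is right because both then have squared A-norm d.\<close>

definition peel :: "real ^ 'm ^ 'm \<Rightarrow> real ^ 'm ^ 'm \<Rightarrow> real \<Rightarrow> real ^ 'm \<Rightarrow> real ^ 'm \<Rightarrow> real ^ 'm ^ 'm"
  where "peel A P d u v = P - (1 / d) *\<^sub>R (outer u u ** A + outer v v ** A)"

lemma peel_mult_vector:
  "peel A P d u v *v x = P *v x - (1 / d) *\<^sub>R (mform A u x *\<^sub>R u + mform A v x *\<^sub>R v)"
  by (simp add: peel_def matrix_vector_mult_diff_rdistrib matrix_vector_mult_add_rdistrib
      outer_mult_vector mform_def flip: matrix_vector_mul_assoc scaleR_matrix_vector_assoc)

text \<open>Skewness, applied to B u paired with u and with v respectively.\<close>

lemma eigenpair_mform: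
  assumes A: "pos_def_matrix A" and B: "transpose B ** A = A ** (- B)"
    and d: "0 < d" and Bu: "B *v u = - d *\<^sub>R v" and Bv: "B *v v = d *\<^sub>R u"
  shows "mform A u v = 0" "mform A v v = mform A u u"
proof -
  have sA: "transpose A = A" using A by (simp add: pos_def_matrix_def)
  have "- (d * mform A v u) = d * mform A u v" using mform_skew[OF B, of u u] by (simp add: Bu mform_simps)
  then have "d * mform A u v = 0" using mform_commute[OF sA, of u v] by simp
  then show "mform A u v = 0" using d by simp
  show "mform A v v = mform A u u" using mform_skew[OF B, of u v] d by (simp add: Bu Bv mform_simps)
qed

text \<open>The plane of u and v is B-invariant and lies in the range of P. Since B is skew, the
  A-orthogonal complement of the plane in that range is invariant too, so the projection R onto it
  commutes with B. Vectors already killed by P stay killed, which preserves the pairs split off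
  before.\<close>

lemma peel_proj_algebra:
  assumes A: "pos_def_matrix A" and B: "transpose B ** A = A ** (- B)"
    and P: "P \<in> proj_algebra A B P" and d: "0 < d"
    and Bu: "B *v u = - d *\<^sub>R v" and Bv: "B *v v = d *\<^sub>R u"
    and Pu: "P *v u = u" and Pv: "P *v v = v" and uu: "mform A u u = d"
  defines "R \<equiv> peel A P d u v"
  shows "R \<in> proj_algebra A B R" "R *v u = 0" "R *v v = 0" "P *v z = 0 \<Longrightarrow> R *v z = 0"
proof -
  have sA: "transpose A = A" using A by (simp add: pos_def_matrix_def)
  note p = proj_algebraD[OF P]
  have Rx: "R *v x = P *v x - (1 / d) *\<^sub>R (mform A u x *\<^sub>R u + mform A v x *\<^sub>R v)" for x
    unfolding R_def by (rule peel_mult_vector)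
  have uv: "mform A u v = 0" "mform A v v = d"
    using eigenpair_mform[OF A B d Bu Bv] uu by auto
  then have vu: "mform A v u = 0" using mform_commute[OF sA, of u v] by simp
  have PP: "P *v (P *v x) = P *v x" for x using p(2) by (simp add: matrix_vector_mul_assoc)
  have PB: "P *v (B *v x) = B *v (P *v x)" for x using p(1) by (simp add: matrix_vector_mul_assoc)
  have uP: "mform A u (P *v x) = mform A u x" for x using mform_adjoint[OF p(4), of u x] by (simp add: Pu)
  have vP: "mform A v (P *v x) = mform A v x" for x using mform_adjoint[OF p(4), of v x] by (simp add: Pv)
  show Ru: "R *v u = 0" using d by (simp add: Rx Pu uu vu)
  show Rv: "R *v v = 0" using d by (simp add: Rx Pv uv)
  show "R *v z = 0" if "P *v z = 0" using uP[of z] vP[of z] that by (simp add: Rx mform_simps)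
  have RP: "R *v (P *v x) = R *v x" for x by (simp add: Rx PP uP vP)
  have RR: "R *v (R *v x) = R *v x" for x
    by (subst (2) Rx) (simp add: matrix_vector_mult_diff_distrib matrix_vector_right_distrib
        matrix_vector_mult_scaleR Ru Rv RP)
  have "R ** R = R" by (simp add: matrix_eq RR flip: matrix_vector_mul_assoc)
  moreover have "R ** B = B ** R"
  proof -
    have "mform A u (B *v x) = d * mform A v x" for x
      using mform_skew[OF B, of u x] by (simp add: Bu mform_simps)
    moreover have "mform A v (B *v x) = - d * mform A u x" for x
      using mform_skew[OF B, of v x] by (simp add: Bv mform_simps)
    ultimately have "R *v (B *v x) = B *v (R *v x)" for x using d
      by (simp add: Rx PB matrix_vector_mult_diff_distrib matrix_vector_right_distrib
        matrix_vector_mult_scaleR Bu Bv algebra_simps)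
    then show ?thesis by (simp add: matrix_eq flip: matrix_vector_mul_assoc)
  qed
  moreover have "transpose R ** A = A ** R"
  proof (rule mform_adjointI)
    fix x y
    show "mform A (R *v x) y = mform A x (R *v y)"
      using mform_adjoint[OF p(4), of x y] mform_commute[OF sA, of x u] mform_commute[OF sA, of x v]
      by (simp add: Rx mform_simps algebra_simps)
  qed
  ultimately show "R \<in> proj_algebra A B R" by (simp add: proj_algebra_def)
qed

text \<open>The induction carries the projection P that remains after removing the pairs found so
  far. The span clause is what bounds its corank: while fewer than \<open>CARD('m)\<close> vectors
  have been removed, P cannot vanish at \<open>t0\<close>.\<close>

lemma analytic_eigenbasis:
  fixes A B :: "real \<Rightarrow> real ^ 'm ^ 'm" and S :: "'k set"
  assumes A: "real_analytic_at A t0" "\<forall>\<^sub>F t in nhds t0. pos_def_matrix (A t)"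
    and B: "real_analytic_at B t0" "\<forall>\<^sub>F t in nhds t0. transpose (B t) ** A t = A t ** (- B t)"
    and inj: "inj ((*v) (B t0))"
    and S: "finite S" "2 * card S \<le> CARD('m)"
  shows "\<exists>d u v P. (\<forall>i\<in>S. real_analytic_at (d i) t0 \<and> real_analytic_at (u i) t0 \<and> real_analytic_at (v i) t0) \<and>
    real_analytic_at P t0 \<and>
    (\<forall>\<^sub>F t in nhds t0. P t \<in> proj_algebra (A t) (B t) (P t) \<and>
      (\<forall>i\<in>S. 0 < d i t \<and> B t *v u i t = - d i t *\<^sub>R v i t \<and> B t *v v i t = d i t *\<^sub>R u i t \<and>
         mform (A t) (u i t) (u i t) = d i t \<and> P t *v u i t = 0 \<and> P t *v v i t = 0) \<and>
      (\<forall>i\<in>S. \<forall>j\<in>S. i \<noteq> j \<longrightarrow> mform (A t) (u i t) (u j t) = 0 \<and>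
         mform (A t) (u i t) (v j t) = 0 \<and> mform (A t) (v i t) (v j t) = 0) \<and>
      (\<forall>x. x - P t *v x \<in> span ((\<lambda>i. u i t) ` S \<union> (\<lambda>i. v i t) ` S)))"
  using S
proof (induction S rule: finite_induct)
  case empty
  show ?case
    by (rule exI, rule exI, rule exI, rule exI[of _ "\<lambda>t. mat 1"])
      (use real_analytic_at_const in \<open>auto simp: proj_algebra_def\<close>)
next
  case (insert k S)
  have "2 * card S \<le> CARD('m)" using insert by simp
  from insert.IH[OF this] obtain d u v P where
    an: "\<forall>i\<in>S. real_analytic_at (d i) t0 \<and> real_analytic_at (u i) t0 \<and> real_analytic_at (v i) t0"
    and Pan: "real_analytic_at P t0"
    and ev: "\<forall>\<^sub>F t in nhds t0. P t \<in> proj_algebra (A t) (B t) (P t) \<and>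
      (\<forall>i\<in>S. 0 < d i t \<and> B t *v u i t = - d i t *\<^sub>R v i t \<and> B t *v v i t = d i t *\<^sub>R u i t \<and>
         mform (A t) (u i t) (u i t) = d i t \<and> P t *v u i t = 0 \<and> P t *v v i t = 0) \<and>
      (\<forall>i\<in>S. \<forall>j\<in>S. i \<noteq> j \<longrightarrow> mform (A t) (u i t) (u j t) = 0 \<and>
         mform (A t) (u i t) (v j t) = 0 \<and> mform (A t) (v i t) (v j t) = 0) \<and>
      (\<forall>x. x - P t *v x \<in> span ((\<lambda>i. u i t) ` S \<union> (\<lambda>i. v i t) ` S))"
    by (elim exE conjE)
  have Pt0: "P t0 \<noteq> 0"
  proof
    \<comment> \<open>Otherwise at most 2 * card S < CARD('m) vectors would span the whole
      space.\<close>
    assume P0: "P t0 = 0"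
    define U where "U = (\<lambda>i. u i t0) ` S \<union> (\<lambda>i. v i t0) ` S"
    have "x \<in> span U" for x
      using eventually_nhds_x_imp_x[OF ev] by (simp add: P0 U_def)
    then have "span U = UNIV" by auto
    then have "dim U = CARD('m)" using dim_span[of U] by (simp add: dim_UNIV)
    moreover have "dim U \<le> card U" using insert by (intro dim_le_card') (auto simp: U_def)
    moreover have "card U \<le> card ((\<lambda>i. u i t0) ` S) + card ((\<lambda>i. v i t0) ` S)"
      unfolding U_def by (rule card_Un_le)
    moreover have "card ((\<lambda>i. u i t0) ` S) \<le> card S" "card ((\<lambda>i. v i t0) ` S) \<le> card S"
      using insert by (auto intro: card_image_le)
    ultimately show False using insert by simp
  qed
  have Pev: "\<forall>\<^sub>F t in nhds t0. P t \<in> proj_algebra (A t) (B t) (P t)"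
    using ev by eventually_elim (rule conjunct1)
  obtain d' u' v' where
    an': "real_analytic_at d' t0" "real_analytic_at u' t0" "real_analytic_at v' t0"
    and ev': "\<forall>\<^sub>F t in nhds t0. 0 < d' t \<and> B t *v u' t = - d' t *\<^sub>R v' t \<and> B t *v v' t = d' t *\<^sub>R u' t \<and>
       P t *v u' t = u' t \<and> P t *v v' t = v' t \<and> mform (A t) (u' t) (u' t) = d' t"
    by (rule analytic_eigenpair[OF A B inj Pan Pev Pt0])
  define R where "R t = peel (A t) (P t) (d' t) (u' t) (v' t)" for t
  define ds where "ds = d(k := d')"
  define us where "us = u(k := u')"
  define vs where "vs = v(k := v')"
  have d0: "0 < d' t0" using eventually_nhds_x_imp_x[OF ev'] by blast
  have Ran: "real_analytic_at R t0" unfolding R_def peel_def using d0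
    by (intro real_analytic_intros real_analytic_at_outer an' A Pan) auto
  have s: "ds i = d i" "us i = u i" "vs i = v i" if "i \<in> S" for i
    using that insert by (auto simp: ds_def us_def vs_def)
  have k: "ds k = d'" "us k = u'" "vs k = v'" by (auto simp: ds_def us_def vs_def)
  have Rev: "\<forall>\<^sub>F t in nhds t0. R t \<in> proj_algebra (A t) (B t) (R t) \<and>
      (\<forall>i\<in>insert k S. 0 < ds i t \<and> B t *v us i t = - ds i t *\<^sub>R vs i t \<and> B t *v vs i t = ds i t *\<^sub>R us i t \<and>
         mform (A t) (us i t) (us i t) = ds i t \<and> R t *v us i t = 0 \<and> R t *v vs i t = 0) \<and>
      (\<forall>i\<in>insert k S. \<forall>j\<in>insert k S. i \<noteq> j \<longrightarrow> mform (A t) (us i t) (us j t) = 0 \<and>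
         mform (A t) (us i t) (vs j t) = 0 \<and> mform (A t) (vs i t) (vs j t) = 0) \<and>
      (\<forall>x. x - R t *v x \<in> span ((\<lambda>i. us i t) ` insert k S \<union> (\<lambda>i. vs i t) ` insert k S))"
    using ev ev' A(2) B(2)
  proof eventually_elim
    case (elim t)
    have P: "P t \<in> proj_algebra (A t) (B t) (P t)" using elim(1) by blast
    have e: "0 < d' t" "B t *v u' t = - d' t *\<^sub>R v' t" "B t *v v' t = d' t *\<^sub>R u' t"
       "P t *v u' t = u' t" "P t *v v' t = v' t" "mform (A t) (u' t) (u' t) = d' t"
      using elim(2) by auto
    note R = peel_proj_algebra[OF elim(3,4) P e, folded R_def]
    have sA: "transpose (A t) = A t" using elim(3) by (simp add: pos_def_matrix_def)
    \<comment> \<open>P is selfadjoint, kills the old vectors and fixes the new ones; hence old and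
      new are A-orthogonal.\<close>
    have orth: "mform (A t) z w = 0" "mform (A t) w z = 0" if "P t *v z = 0" "P t *v w = w" for z w
    proof -
      show "mform (A t) z w = 0"
        using mform_adjoint[OF proj_algebraD(4)[OF P], of z w] that by (simp add: mform_simps)
      then show "mform (A t) w z = 0" using mform_commute[OF sA] by metis
    qed
    define X where "X = span ((\<lambda>i. us i t) ` insert k S \<union> (\<lambda>i. vs i t) ` insert k S)"
    have "span ((\<lambda>i. u i t) ` S \<union> (\<lambda>i. v i t) ` S) \<subseteq> X"
      unfolding X_def by (intro span_mono) (use s in force)
    then have x1: "x - P t *v x \<in> X" for x using elim(1) by blast
    have x2: "u' t \<in> X" "v' t \<in> X" unfolding X_def using k by (auto intro!: span_base)
    have "x - R t *v x \<in> X" for x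
    proof -
      have "x - R t *v x = (x - P t *v x) +
        (1 / d' t) *\<^sub>R (mform (A t) (u' t) x *\<^sub>R u' t + mform (A t) (v' t) x *\<^sub>R v' t)"
        unfolding R_def peel_mult_vector by simp
      also have "\<dots> \<in> X" using x1 x2 unfolding X_def by (intro span_add span_scale)
      finally show ?thesis .
    qed
    moreover have "\<forall>i\<in>insert k S. 0 < ds i t \<and> B t *v us i t = - ds i t *\<^sub>R vs i t \<and> B t *v vs i t = ds i t *\<^sub>R us i t \<and>
         mform (A t) (us i t) (us i t) = ds i t \<and> R t *v us i t = 0 \<and> R t *v vs i t = 0"
      using elim(1) e R by (simp add: k s)
    moreover have "\<forall>i\<in>insert k S. \<forall>j\<in>insert k S. i \<noteq> j \<longrightarrow> mform (A t) (us i t) (us j t) = 0 \<and>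
         mform (A t) (us i t) (vs j t) = 0 \<and> mform (A t) (vs i t) (vs j t) = 0"
      using elim(1) e(4,5) orth by (simp add: k s)
    ultimately show ?case using R(1) unfolding X_def by (intro conjI allI)
  qed
  have ans: "\<forall>i\<in>insert k S. real_analytic_at (ds i) t0 \<and> real_analytic_at (us i) t0 \<and> real_analytic_at (vs i) t0"
    using an an' by (simp add: k s)
  show ?case
    by (rule exI[of _ ds], rule exI[of _ us], rule exI[of _ vs], rule exI[of _ R])
      (intro conjI Ran Rev ans)
qed

subsection \<open>Williamson's normal form\<close>

lemma sum_UNIV_Plus: "(\<Sum>k\<in>UNIV. f k) = (\<Sum>i\<in>UNIV. f (Inl i)) + (\<Sum>i\<in>UNIV. f (Inr i))"
  for f :: "'a::finite + 'b::finite \<Rightarrow> 'c::comm_monoid_add"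
  unfolding UNIV_Plus_UNIV[symmetric] by (subst sum.Plus) (simp_all add: o_def)

lemma all_Plus_iff: "(\<forall>k. Q k) \<longleftrightarrow> (\<forall>i. Q (Inl i)) \<and> (\<forall>i. Q (Inr i))"
  by (metis sum.exhaust)

lemma symp_J_mult_nth:
  "(symp_J *v x) $ Inl i = x $ Inr i" "(symp_J *v x) $ Inr i = - x $ Inl i"
  by (simp_all add: symp_J_def block_matrix_def matrix_vector_mult_def sum_UNIV_Plus mat_def
      if_distrib[where f = "\<lambda>a. a * _"] sum_negf cong: if_cong)

lemma symp_J_nth:
  "symp_J $ Inl i $ Inl j = 0" "symp_J $ Inl i $ Inr j = (if i = j then 1 else 0)"
  "symp_J $ Inr i $ Inl j = (if i = j then - 1 else 0)" "symp_J $ Inr i $ Inr j = 0"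
  by (simp_all add: symp_J_def block_matrix_def mat_def)

lemma symp_J_twice: "symp_J *v (symp_J *v x) = - x"
  by (simp add: vec_eq_iff all_Plus_iff symp_J_mult_nth)

lemma symp_J_square: "symp_J ** symp_J = - mat 1"
  by (simp add: matrix_eq symp_J_twice matrix_vector_mult_minus_left flip: matrix_vector_mul_assoc)

lemma transpose_symp_J: "transpose symp_J = - symp_J"
  by (simp add: vec_eq_iff all_Plus_iff transpose_def symp_J_nth)

lemma inner_symp_J: "x \<bullet> (symp_J *v y) = - (y \<bullet> (symp_J *v x))"
  using inner_matrix_transpose[of x symp_J y]
  by (simp add: transpose_symp_J matrix_vector_mult_minus_left inner_commute del: transpose_matrix_vector)

lemma symp_J_mult_skew:
  assumes "pos_def_matrix A"
  shows "transpose (symp_J ** A) ** A = A ** (- (symp_J ** A))"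
proof -
  have "transpose A = A" using assms by (simp add: pos_def_matrix_def)
  then show ?thesis
    by (simp add: matrix_transpose_mul transpose_symp_J matrix_mult_minus_left
        matrix_mult_minus_right matrix_mul_assoc)
qed

lemma inj_symp_J_mult:
  assumes "pos_def_matrix A"
  shows "inj ((*v) (symp_J ** A))"
  unfolding linear_injective_0[OF matrix_vector_mul_linear]
proof (intro allI impI)
  fix x assume "(symp_J ** A) *v x = 0"
  then have "A *v x = 0" using symp_J_twice[of "A *v x"] by (simp add: matrix_vector_mul_assoc)
  then show "x = 0" using mform_pos[OF assms, of x] by (auto simp: mform_def)
qed

text \<open>Applying J to the equations for J A gives A u = d J v and A v = -d J u, since J^2 = -1.
  Every A-pairing is then d or -d times a J-pairing, and dividing by d gives symplectic
  orthonormality.\<close>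

lemma symp_eigenbasis_of_mform:
  assumes A: "pos_def_matrix A" and d: "\<And>i. 0 < d i"
    and e: "\<And>i. (symp_J ** A) *v u i = - d i *\<^sub>R v i" "\<And>i. (symp_J ** A) *v v i = d i *\<^sub>R u i"
    and n: "\<And>i. mform A (u i) (u i) = d i"
    and o: "\<And>i j. i \<noteq> j \<Longrightarrow> mform A (u i) (u j) = 0 \<and> mform A (u i) (v j) = 0 \<and> mform A (v i) (v j) = 0"
  shows "symp_eigenbasis A d u v"
proof -
  have Au: "A *v u i = d i *\<^sub>R (symp_J *v v i)" for i
    using symp_J_twice[of "A *v u i"] e(1)[of i]
    by (simp add: matrix_vector_mult_scaleR matrix_vector_mult_minus_right flip: matrix_vector_mul_assoc)
  have Av: "A *v v i = (- d i) *\<^sub>R (symp_J *v u i)" for i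
    using symp_J_twice[of "A *v v i"] e(2)[of i]
    by (simp add: matrix_vector_mult_scaleR flip: matrix_vector_mul_assoc)
  have uv: "mform A (u i) (v i) = 0" "mform A (v i) (v i) = d i" for i
    using eigenpair_mform[OF A symp_J_mult_skew[OF A] d e] n by auto
  have "symp_orthonormal UNIV u v" unfolding symp_orthonormal_def
  proof (intro ballI conjI)
    fix i j
    have "d j * (u i \<bullet> (symp_J *v v j)) = mform A (u i) (u j)" by (simp add: mform_def Au)
    also have "\<dots> = d j * (if i = j then 1 else 0)" using n o by simp
    finally show "u i \<bullet> (symp_J *v v j) = (if i = j then 1 else 0)" using d[of j] by simp
    have "- d j * (u i \<bullet> (symp_J *v u j)) = mform A (u i) (v j)" by (simp add: mform_def Av)
    also have "\<dots> = 0" using o uv by (cases "i = j") auto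
    finally show "u i \<bullet> (symp_J *v u j) = 0" using d[of j] by simp
    have sA: "transpose A = A" using A by (simp add: pos_def_matrix_def)
    have "d j * (v i \<bullet> (symp_J *v v j)) = mform A (v i) (u j)" by (simp add: mform_def Au)
    also have "\<dots> = mform A (u j) (v i)" by (rule mform_commute[OF sA])
    also have "\<dots> = 0" using o uv by (cases "i = j") auto
    finally show "v i \<bullet> (symp_J *v v j) = 0" using d[of j] by simp
  qed
  then show ?thesis
    unfolding symp_eigenbasis_def symp_basis_def symp_eigenpair_def using Au Av by blast
qed

section \<open>Eigenbases, normal forms and multiplicities\<close>

lemma conjugate_matrix_nth: "(transpose M ** X ** M) $ a $ b = column a M \<bullet> (X *v column b M)"
  for M X :: "real ^ 'm ^ 'm"
proof -
  have "(transpose M ** (X ** M)) $ a $ b = column a M \<bullet> (X *v column b M)"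
    by (simp add: matrix_matrix_mult_def matrix_vector_mult_def transpose_def column_def inner_vec_def)
  then show ?thesis by (simp add: matrix_mul_assoc)
qed

text \<open>Take the basis vectors as the columns of M. Entries of a conjugated matrix are pairings
  of columns, so both identities become the orthonormality relations.\<close>

lemma symp_eigenbasis_williamson:
  assumes "symp_eigenbasis A d u v"
  shows "\<exists>M. symplectic M \<and> transpose M ** A ** M = block_matrix (diag_matrix d) 0 0 (diag_matrix d)"
proof -
  have Au: "A *v u i = d i *\<^sub>R (symp_J *v v i)" and Av: "A *v v i = (- d i) *\<^sub>R (symp_J *v u i)" for i
    using assms by (auto simp: symp_eigenbasis_def symp_eigenpair_def)
  have J: "u i \<bullet> (symp_J *v v j) = (if i = j then 1 else 0)" "u i \<bullet> (symp_J *v u j) = 0"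
    "v i \<bullet> (symp_J *v v j) = 0" for i j
    using assms by (auto simp: symp_eigenbasis_def symp_basis_def symp_orthonormal_def)
  have J': "v i \<bullet> (symp_J *v u j) = (if i = j then - 1 else 0)" for i j
    using J(1)[of j i] inner_symp_J[of "v i" "u j"] by auto
  define M where "M = (\<chi> r c. (case c of Inl i \<Rightarrow> u i $ r | Inr i \<Rightarrow> v i $ r))"
  have M: "column (Inl i) M = u i" "column (Inr i) M = v i" for i
    by (simp_all add: column_def M_def vec_eq_iff)
  have "symplectic M" unfolding symplectic_def
    by (simp add: vec_eq_iff all_Plus_iff conjugate_matrix_nth M J J' symp_J_nth)
  moreover have "transpose M ** A ** M = block_matrix (diag_matrix d) 0 0 (diag_matrix d)"
    by (simp add: vec_eq_iff all_Plus_iff conjugate_matrix_nth M J J' Au Av block_matrix_def diag_matrix_def)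
  ultimately show ?thesis by blast
qed

lemma block_diag_mult_nth:
  "(block_matrix (diag_matrix d) 0 0 (diag_matrix d) *v y) $ Inl i = d i * y $ Inl i"
  "(block_matrix (diag_matrix d) 0 0 (diag_matrix d) *v y) $ Inr i = d i * y $ Inr i"
  by (simp_all add: block_matrix_def diag_matrix_def matrix_vector_mult_def sum_UNIV_Plus
      if_distrib[where f = "\<lambda>a. a * _"] sum.delta cong: if_cong)

text \<open>The left side does not mention M or d, so it determines the multiplicity of each value
  from A alone. The factor 2 appears because M carries (J A)^2 to a diagonal matrix in which each
  d_i contributes two entries -d_i^2.\<close>

lemma dim_williamson_eigenspace:
  fixes A :: "real ^ ('n::finite + 'n) ^ ('n + 'n)"
  assumes M: "symplectic M" and D: "transpose M ** A ** M = block_matrix (diag_matrix d) 0 0 (diag_matrix d)"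
    and d: "\<And>i. 0 < d i" and c: "0 < c"
  shows "dim {x. symp_J *v (A *v (symp_J *v (A *v x))) = - (c * c) *\<^sub>R x} = 2 * card {i. d i = c}"
proof -
  define \<Delta> where "\<Delta> = block_matrix (diag_matrix d) 0 0 (diag_matrix d)"
  define J where "J = (symp_J :: real ^ ('n + 'n) ^ ('n + 'n))"
  have JJ: "J ** J = - mat 1" by (simp add: J_def symp_J_square)
  have MJM: "transpose M ** J ** M = J" using M by (simp add: symplectic_def J_def)
  \<comment> \<open>An explicit left inverse of the symplectic M. Being two-sided, it gives M J M^T
    = J, and then J A M = M J \<Delta>.\<close>
  have "(- (J ** transpose M ** J)) ** M = - (J ** (transpose M ** J ** M))"
    by (simp add: matrix_mult_minus_left matrix_mul_assoc)
  also have "\<dots> = mat 1" by (simp add: MJM JJ)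
  finally have LM: "(- (J ** transpose M ** J)) ** M = mat 1" .
  then have "M ** (- (J ** transpose M ** J)) = mat 1" by (rule matrix_left_right_inverse1)
  then have "(M ** (- (J ** transpose M ** J))) ** J = J" by simp
  moreover have "(M ** (- (J ** transpose M ** J))) ** J = - (M ** J ** transpose M ** (J ** J))"
    by (simp add: matrix_mult_minus_left matrix_mult_minus_right matrix_mul_assoc)
  ultimately have MJMt: "M ** J ** transpose M = J" by (simp add: JJ matrix_mult_minus_right)
  have "J ** A ** M = M ** J ** (transpose M ** A ** M)" by (metis MJMt matrix_mul_assoc)
  then have JAM: "J ** A ** M = M ** J ** \<Delta>" using D by (simp add: \<Delta>_def)
  have BM: "J *v (A *v (M *v y)) = M *v (J *v (\<Delta> *v y))" for y
    using JAM by (simp add: matrix_vector_mul_assoc matrix_mul_assoc)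
  have inj: "inj ((*v) M)" using LM by (metis matrix_left_invertible_injective)
  have surj: "surj ((*v) M)"
    using LM matrix_left_right_inverse1 by (metis matrix_right_invertible_surjective)
  define \<delta> where "\<delta> k = (case k of Inl i \<Rightarrow> d i | Inr i \<Rightarrow> d i)" for k
  have JDJD: "(J *v (\<Delta> *v (J *v (\<Delta> *v y)))) $ k = - (\<delta> k * \<delta> k) * y $ k" for y k
    by (cases k) (simp_all add: J_def \<Delta>_def symp_J_mult_nth block_diag_mult_nth \<delta>_def)
  have \<delta>: "0 < \<delta> k" for k using d by (simp add: \<delta>_def split: sum.split)
  \<comment> \<open>Positivity of \<delta> and c excludes \<delta> = -c, the other root.\<close>
  have sq: "- (\<delta> k * \<delta> k) * z = - (c * c) * z \<longleftrightarrow> (\<delta> k \<noteq> c \<longrightarrow> z = 0)" for k z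
    using \<delta>[of k] c by (auto simp: square_eq_iff)
  let ?L = "{x. J *v (A *v (J *v (A *v x))) = - (c * c) *\<^sub>R x}"
  let ?Y = "{y :: real ^ ('n + 'n). \<forall>k. k \<notin> {k. \<delta> k = c} \<longrightarrow> y $ k = 0}"
  have "J *v (A *v (J *v (A *v (M *v y)))) = - (c * c) *\<^sub>R (M *v y) \<longleftrightarrow> (\<forall>k. k \<notin> {k. \<delta> k = c} \<longrightarrow> y $ k = 0)" for y
  proof -
    have "J *v (A *v (J *v (A *v (M *v y)))) = - (c * c) *\<^sub>R (M *v y) \<longleftrightarrow>
        M *v (J *v (\<Delta> *v (J *v (\<Delta> *v y)))) = M *v ((- (c * c)) *\<^sub>R y)"
      by (simp only: BM matrix_vector_mult_scaleR)
    also have "\<dots> \<longleftrightarrow> J *v (\<Delta> *v (J *v (\<Delta> *v y))) = (- (c * c)) *\<^sub>R y"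
      using inj by (metis injD)
    also have "\<dots> \<longleftrightarrow> (\<forall>k. k \<notin> {k. \<delta> k = c} \<longrightarrow> y $ k = 0)"
      unfolding vec_eq_iff JDJD vector_scaleR_component real_scaleR_def sq by simp
    finally show ?thesis .
  qed
  then have key: "M *v y \<in> ?L \<longleftrightarrow> y \<in> ?Y" for y by (simp only: mem_Collect_eq)
  have "?L = (*v) M ` ?Y"
  proof (intro equalityI subsetI)
    fix x assume x: "x \<in> ?L"
    obtain y where y: "x = M *v y" using surj by (rule surjE)
    then have "y \<in> ?Y" using x key by simp
    then show "x \<in> (*v) M ` ?Y" using y by (rule rev_image_eqI)
  next
    fix x assume "x \<in> (*v) M ` ?Y"
    then obtain y where "y \<in> ?Y" "x = M *v y" by (rule imageE)
    then show "x \<in> ?L" using key by simp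
  qed
  moreover have "dim ((*v) M ` ?Y) = dim ?Y"
    by (rule dim_image_eq[OF matrix_vector_mul_linear inj_on_subset[OF inj subset_UNIV]])
  ultimately have "dim ?L = dim ?Y" by simp
  also have "\<dots> = card {k. \<delta> k = c}" using dim_substandard_cart[where 'a = real and d = "{k. \<delta> k = c}"]
    by (simp only: dim_vec_eq)
  also have "{k. \<delta> k = c} = {i. d i = c} <+> {i. d i = c}"
  proof (rule set_eqI)
    show "k \<in> {k. \<delta> k = c} \<longleftrightarrow> k \<in> {i. d i = c} <+> {i. d i = c}" for k
      by (cases k) (auto simp: \<delta>_def)
  qed
  also have "card \<dots> = 2 * card {i. d i = c}" by (simp add: card_Plus)
  finally show ?thesis by (simp add: J_def)
qed

text \<open>Equal multiplicities give sublevel sets of equal size. If f i < g i, then g has fewer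
  arguments with value at most f i (all lie below i) than f has (at least all up to i).\<close>

lemma mono_eq_of_card_eq:
  fixes d e :: "'n::{finite,linorder} \<Rightarrow> real"
  assumes d: "mono d" and e: "mono e" and c: "\<And>x. card {i. d i = x} = card {i. e i = x}"
  shows "d = e"
proof -
  \<comment> \<open>The fibres are summed over a set R given in advance, so that the same index set
    can be used for d and e.\<close>
  have le: "card {i. f i \<le> x} = (\<Sum>y\<in>{y \<in> R. y \<le> x}. card {i. f i = y})"
    if "finite R" "\<And>i. f i \<in> R" for f :: "'n \<Rightarrow> real" and x R
  proof -
    have "{i. f i \<le> x} = (\<Union>y\<in>{y \<in> R. y \<le> x}. {i. f i = y})" using that(2) by auto
    then show ?thesis using that(1) by (subst card_UN_disjoint[symmetric]) auto
  qed
  have eq: "card {i. d i \<le> x} = card {i. e i \<le> x}" for x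
    using le[of "range d \<union> range e" d x] le[of "range d \<union> range e" e x] c by simp
  have "\<not> f i < g i" if f: "mono f" and g: "mono g" and eq: "\<And>x. card {i. f i \<le> x} = card {i. g i \<le> x}"
    for f g :: "'n \<Rightarrow> real" and i
  proof
    assume lt: "f i < g i"
    have "{j. g j \<le> f i} \<subseteq> {j. j < i}"
    proof
      fix j assume "j \<in> {j. g j \<le> f i}"
      then have "\<not> i \<le> j" using lt monoD[OF g, of i j] by auto
      then show "j \<in> {j. j < i}" by simp
    qed
    moreover have "{j. j < i} \<subset> {j. j \<le> i}" by auto
    moreover have "{j. j \<le> i} \<subseteq> {j. f j \<le> f i}" using monoD[OF f] by auto
    ultimately have "card {j. g j \<le> f i} < card {j. f j \<le> f i}"
      by (intro psubset_card_mono) auto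
    then show False using eq by simp
  qed
  then have "\<not> d i < e i" "\<not> e i < d i" for i using d e eq by metis+
  then show ?thesis by (metis ext linorder_neqE)
qed

text \<open>The uniqueness half of Williamson's theorem: eigenspace dimensions fix all
  multiplicities, and monotonicity fixes the order. It makes the description in
  \<open>symp_eigval\<close> usable.\<close>

lemma symp_eigval_eqI:
  fixes A :: "real ^ ('n::{finite,linorder} + 'n) ^ ('n + 'n)"
  assumes "symplectic M" "transpose M ** A ** M = block_matrix (diag_matrix d) 0 0 (diag_matrix d)"
    and "\<And>i. 0 < d i" "mono d"
  shows "symp_eigval A = d"
  unfolding symp_eigval_def
proof (rule the_equality)
  show "(\<forall>i. 0 < d i) \<and> mono d \<and> (\<exists>M. symplectic M \<and>
         transpose M ** A ** M = block_matrix (diag_matrix d) 0 0 (diag_matrix d))"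
    using assms by blast
next
  fix e assume e: "(\<forall>i. 0 < e i) \<and> mono e \<and> (\<exists>M. symplectic M \<and>
         transpose M ** A ** M = block_matrix (diag_matrix e) 0 0 (diag_matrix e))"
  then obtain M' where M': "symplectic M'"
    "transpose M' ** A ** M' = block_matrix (diag_matrix e) 0 0 (diag_matrix e)" by blast
  have "card {i. e i = c} = card {i. d i = c}" for c
  proof (cases "0 < c")
    case True
    then show ?thesis
      using dim_williamson_eigenspace[OF assms(1,2,3) True] dim_williamson_eigenspace[OF M' _ True] e by simp
  next
    case False
    have "e i \<noteq> c" "d i \<noteq> c" for i using False e assms(3)[of i] by auto
    then show ?thesis by simp
  qed
  then show "e = d" using e assms(4) by (intro mono_eq_of_card_eq) auto
qed

text \<open>The largest index is sent to an element of T where d is maximal, and the rest is handled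
  by induction.\<close>

lemma sorting_bijection:
  fixes d :: "'a \<Rightarrow> real" and S :: "'b::linorder set"
  assumes "finite S" "finite T" "card S = card T"
  shows "\<exists>f. bij_betw f S T \<and> mono_on S (\<lambda>i. d (f i))"
  using assms
proof (induction S arbitrary: T rule: finite_linorder_max_induct)
  case empty
  then show ?case by (auto simp: bij_betw_def)
next
  case (insert b S)
  have b: "b \<notin> S" using insert by auto
  have "T \<noteq> {}" using insert b by auto
  then have "Max (d ` T) \<in> d ` T" using insert.prems by (intro Max_in) auto
  then obtain m where m: "m \<in> T" "Max (d ` T) = d m" by auto
  have max: "d y \<le> d m" if "y \<in> T" for y
    unfolding m(2)[symmetric] using insert.prems that by (intro Max_ge) auto
  have "card S = card (T - {m})" using insert b m by simp
  then obtain f where f: "bij_betw f S (T - {m})" "mono_on S (\<lambda>i. d (f i))"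
    using insert.IH[of "T - {m}"] insert.prems by auto
  define g where "g = f(b := m)"
  have g: "g b = m" "\<And>i. i \<in> S \<Longrightarrow> g i = f i" using b by (auto simp: g_def)
  have "bij_betw g S (T - {m})" using f(1) g(2) by (simp cong: bij_betw_cong)
  then have "bij_betw g (S \<union> {b}) (T - {m} \<union> {g b})"
    by (rule notIn_Un_bij_betw[rotated 2]) (use b g in auto)
  moreover have "S \<union> {b} = insert b S" "T - {m} \<union> {g b} = T" using g m by auto
  ultimately have "bij_betw g (insert b S) T" by simp
  moreover have "mono_on (insert b S) (\<lambda>i. d (g i))"
  proof (rule mono_onI)
    fix r s assume rs: "r \<in> insert b S" "s \<in> insert b S" "r \<le> s"
    show "d (g r) \<le> d (g s)"
    proof (cases "s = b")
      case True
      have "g r \<in> T" using \<open>bij_betw g (insert b S) T\<close> rs by (auto simp: bij_betw_def)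
      then show ?thesis using True g max by simp
    next
      case False
      then have "s \<in> S" "r \<in> S" using rs insert.hyps by auto
      then show ?thesis using f(2) rs g by (auto dest: mono_onD)
    qed
  qed
  ultimately show ?case by blast
qed

lemma symp_eigenbasis_reindex:
  assumes "symp_eigenbasis A d u v" "bij p"
  shows "symp_eigenbasis A (\<lambda>i. d (p i)) (\<lambda>i. u (p i)) (\<lambda>i. v (p i))"
  using assms by (simp add: symp_eigenbasis_def symp_basis_def symp_orthonormal_def bij_def inj_eq)

text \<open>Analytic branches may cross, so d need not be monotone. Sorting the basis gives a
  Williamson form, and the inverse of the sorting permutation returns to the given order. Existence
  in Williamson's theorem for A is contained in the hypothesis.\<close>

lemma symp_eigenbasis_eigval:
  fixes A :: "real ^ ('n::{finite,linorder} + 'n) ^ ('n + 'n)"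
  assumes e: "symp_eigenbasis A d u v" and d: "\<And>i. 0 < d i"
  shows "\<exists>p. p permutes UNIV \<and> (\<forall>i. d i = symp_eigval A (p i))"
proof -
  obtain p :: "'n \<Rightarrow> 'n" where p: "bij p" "mono (\<lambda>i. d (p i))"
    using sorting_bijection[of "UNIV :: 'n set" "UNIV :: 'n set" d] by auto
  obtain M where "symplectic M"
    "transpose M ** A ** M = block_matrix (diag_matrix (\<lambda>i. d (p i))) 0 0 (diag_matrix (\<lambda>i. d (p i)))"
    using symp_eigenbasis_williamson[OF symp_eigenbasis_reindex[OF e p(1)]] by blast
  then have ev: "symp_eigval A = (\<lambda>i. d (p i))"
    by (rule symp_eigval_eqI) (use d p in auto)
  have "inv p permutes UNIV" by (intro bij_imp_permutes bij_imp_bij_inv p) auto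
  moreover have "d i = symp_eigval A (inv p i)" for i
    using p(1) by (simp add: ev bij_is_surj surj_f_inv_f)
  ultimately show ?thesis by blast
qed

section \<open>Assembly of the analytic families\<close>

lemma analytic_symp_eigenbasis:
  fixes A :: "real \<Rightarrow> real^('n::{finite,linorder} + 'n)^('n + 'n)"
  assumes A: "real_analytic_at A t0" and pd: "\<forall>\<^sub>F t in nhds t0. pos_def_matrix (A t)"
  obtains d u v where
    "\<forall>i :: 'n. real_analytic_at (d i) t0 \<and> real_analytic_at (u i) t0 \<and> real_analytic_at (v i) t0"
    "\<forall>\<^sub>F t in nhds t0. (\<exists>p. p permutes UNIV \<and> (\<forall>i. d i t = symp_eigval (A t) (p i))) \<and>
       symp_eigenbasis (A t) (\<lambda>i. d i t) (\<lambda>i. u i t) (\<lambda>i. v i t)"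
proof -
  have B: "real_analytic_at (\<lambda>t. symp_J ** A t) t0" by (intro real_analytic_intros A)
  have sk: "\<forall>\<^sub>F t in nhds t0. transpose (symp_J ** A t) ** A t = A t ** (- (symp_J ** A t))"
    using pd by eventually_elim (rule symp_J_mult_skew)
  have inj: "inj ((*v) (symp_J ** A t0))" using inj_symp_J_mult[OF eventually_nhds_x_imp_x[OF pd]] .
  \<comment> \<open>The n pairs exhaust the dimension 2n exactly, so the index set may be all of
    'n.\<close>
  have "card (UNIV :: ('n + 'n) set) = 2 * CARD('n)"
    unfolding UNIV_Plus_UNIV[symmetric] by (subst card_Plus) auto
  then have c: "2 * card (UNIV :: 'n set) \<le> CARD('n + 'n)" by simp
  from analytic_eigenbasis[OF A pd B sk inj finite c]
  obtain d u v P where an: "\<forall>i :: 'n. real_analytic_at (d i) t0 \<and> real_analytic_at (u i) t0 \<and> real_analytic_at (v i) t0"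
    and ev: "\<forall>\<^sub>F t in nhds t0. P t \<in> proj_algebra (A t) (symp_J ** A t) (P t) \<and>
      (\<forall>i. 0 < d i t \<and> (symp_J ** A t) *v u i t = - d i t *\<^sub>R v i t \<and> (symp_J ** A t) *v v i t = d i t *\<^sub>R u i t \<and>
         mform (A t) (u i t) (u i t) = d i t \<and> P t *v u i t = 0 \<and> P t *v v i t = 0) \<and>
      (\<forall>i j. i \<noteq> j \<longrightarrow> mform (A t) (u i t) (u j t) = 0 \<and>
         mform (A t) (u i t) (v j t) = 0 \<and> mform (A t) (v i t) (v j t) = 0) \<and>
      (\<forall>x. x - P t *v x \<in> span (range (\<lambda>i. u i t) \<union> range (\<lambda>i. v i t)))"
    unfolding ball_UNIV by (elim exE conjE)
  show ?thesis
  proof (rule that[of d u v])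
    show "\<forall>\<^sub>F t in nhds t0. (\<exists>p. p permutes UNIV \<and> (\<forall>i. d i t = symp_eigval (A t) (p i))) \<and>
       symp_eigenbasis (A t) (\<lambda>i. d i t) (\<lambda>i. u i t) (\<lambda>i. v i t)"
      using ev pd
    proof eventually_elim
      case (elim t)
      have "symp_eigenbasis (A t) (\<lambda>i. d i t) (\<lambda>i. u i t) (\<lambda>i. v i t)"
        by (rule symp_eigenbasis_of_mform[OF elim(2)]) (use elim(1) in blast)+
      moreover from this have "\<exists>p. p permutes UNIV \<and> (\<forall>i. d i t = symp_eigval (A t) (p i))"
        by (rule symp_eigenbasis_eigval) (use elim(1) in blast)
      ultimately show ?case by blast
    qed
  qed (use an in auto)
qed

theorem theorem4p3:
  fixes A :: "real \<Rightarrow> real^('n::{finite,linorder} + 'n)^('n + 'n)"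
    and I :: "real set" and t0 :: real
  assumes "open I" and "is_interval I" and "t0 \<in> I"
    and "\<And>t. t \<in> I \<Longrightarrow> pos_def_matrix (A t)"
    and "real_analytic_at A t0"
  shows "(\<forall>d m. is_symp_eigval (A t0) d \<and> symp_multiplicity (A t0) d = m \<longrightarrow>
           (\<exists>\<epsilon>>0. {t0 - \<epsilon><..<t0 + \<epsilon>} \<subseteq> I \<and>
             (\<exists>(dt :: nat \<Rightarrow> real \<Rightarrow> real)
                (u :: nat \<Rightarrow> real \<Rightarrow> real^('n + 'n)) (v :: nat \<Rightarrow> real \<Rightarrow> real^('n + 'n)).
               (\<forall>j\<in>{1..m}. real_analytic_at (dt j) t0 \<and>
                  real_analytic_at (u j) t0 \<and> real_analytic_at (v j) t0) \<and>
               (\<forall>t\<in>{t0 - \<epsilon><..<t0 + \<epsilon>}.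
                  (\<forall>j\<in>{1..m}. is_symp_eigval (A t) (dt j t) \<and>
                     symp_eigenpair (A t) (dt j t) (u j t) (v j t)) \<and>
                  symp_orthonormal {1..m} (\<lambda>j. u j t) (\<lambda>j. v j t)) \<and>
               (\<forall>j\<in>{1..m}. dt j t0 = d))))
       \<and> (\<exists>\<epsilon>>0. {t0 - \<epsilon><..<t0 + \<epsilon>} \<subseteq> I \<and>
             (\<exists>(dt :: 'n \<Rightarrow> real \<Rightarrow> real)
                (u :: 'n \<Rightarrow> real \<Rightarrow> real^('n + 'n)) (v :: 'n \<Rightarrow> real \<Rightarrow> real^('n + 'n)).
               (\<forall>i. real_analytic_at (dt i) t0 \<and>
                  real_analytic_at (u i) t0 \<and> real_analytic_at (v i) t0) \<and>
               (\<forall>t\<in>{t0 - \<epsilon><..<t0 + \<epsilon>}.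
                  (\<exists>p. p permutes UNIV \<and> (\<forall>i. dt i t = symp_eigval (A t) (p i))) \<and>
                  symp_eigenbasis (A t) (\<lambda>i. dt i t) (\<lambda>i. u i t) (\<lambda>i. v i t))))"
proof -
  have I: "\<forall>\<^sub>F t in nhds t0. t \<in> I" using assms(1,3) by (rule eventually_nhds_in_open)
  then have "\<forall>\<^sub>F t in nhds t0. pos_def_matrix (A t)"
    by eventually_elim (rule assms(4))
  then obtain d u v where
    an: "\<forall>i :: 'n. real_analytic_at (d i) t0 \<and> real_analytic_at (u i) t0 \<and> real_analytic_at (v i) t0"
    and ev: "\<forall>\<^sub>F t in nhds t0. (\<exists>p. p permutes UNIV \<and> (\<forall>i. d i t = symp_eigval (A t) (p i))) \<and>
       symp_eigenbasis (A t) (\<lambda>i. d i t) (\<lambda>i. u i t) (\<lambda>i. v i t)"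
    by (rule analytic_symp_eigenbasis[OF assms(5)])
  from I ev have "\<forall>\<^sub>F t in nhds t0. t \<in> I \<and> (\<exists>p. p permutes UNIV \<and> (\<forall>i. d i t = symp_eigval (A t) (p i))) \<and>
       symp_eigenbasis (A t) (\<lambda>i. d i t) (\<lambda>i. u i t) (\<lambda>i. v i t)"
    by eventually_elim blast
  then obtain \<epsilon> where \<epsilon>: "\<epsilon> > 0" and near: "\<And>t. dist t t0 < \<epsilon> \<Longrightarrow> t \<in> I \<and>
      (\<exists>p. p permutes UNIV \<and> (\<forall>i. d i t = symp_eigval (A t) (p i))) \<and>
       symp_eigenbasis (A t) (\<lambda>i. d i t) (\<lambda>i. u i t) (\<lambda>i. v i t)"
    unfolding eventually_nhds_metric by blast
  have dist: "dist t t0 < \<epsilon>" if "t \<in> {t0 - \<epsilon><..<t0 + \<epsilon>}" for t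
    using that by (auto simp: dist_real_def)
  have sub: "{t0 - \<epsilon><..<t0 + \<epsilon>} \<subseteq> I" using near dist by blast
  show ?thesis
  proof (intro conjI allI impI, goal_cases)
    \<comment> \<open>Select from the full family the indices whose branch takes the value e at
      \<open>t0\<close>; the permutation at \<open>t0\<close> shows that there are m of
      them.\<close>
    case em: (1 e m)
    obtain p where p: "p permutes UNIV" "\<And>i. d i t0 = symp_eigval (A t0) (p i)"
      using near[of t0] \<epsilon> by auto
    have "bij_betw p {i. d i t0 = e} {i. symp_eigval (A t0) i = e}"
    proof (rule bij_betwI')
      show "p x = p y \<longleftrightarrow> x = y" for x y using p(1) by (metis permutes_inj injD)
      show "\<exists>x\<in>{i. d i t0 = e}. y = p x" if "y \<in> {i. symp_eigval (A t0) i = e}" for y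
        using that p permutes_surj[OF p(1)] by (metis (mono_tags, lifting) mem_Collect_eq surjD)
    qed (use p in auto)
    then have "card {i. d i t0 = e} = m"
      using em by (simp add: symp_multiplicity_def bij_betw_same_card)
    then obtain g where g: "bij_betw g {1..m} {i. d i t0 = e}"
      using ex_bij_betw_nat_finite_1[of "{i. d i t0 = e}"] by auto
    \<comment> \<open>Injectivity of the enumeration turns the Kronecker delta on 'n into the one on
      {1..m}.\<close>
    have inj: "g i = g j \<longleftrightarrow> i = j" if "i \<in> {1..m}" "j \<in> {1..m}" for i j
      using g that by (metis bij_betw_imp_inj_on inj_on_eq_iff)
    show ?case
    proof (rule exI[of _ \<epsilon>], intro conjI, goal_cases)
      case 3
      show ?case
      proof (rule exI[of _ "\<lambda>j. d (g j)"], rule exI[of _ "\<lambda>j. u (g j)"],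
          rule exI[of _ "\<lambda>j. v (g j)"], intro conjI ballI)
      fix t assume t: "t \<in> {t0 - \<epsilon><..<t0 + \<epsilon>}"
      note n = near[OF dist[OF t]]
      show "is_symp_eigval (A t) (d (g j) t)" for j using n by (auto simp: is_symp_eigval_def)
      show "symp_eigenpair (A t) (d (g j) t) (u (g j) t) (v (g j) t)" for j
        using n by (auto simp: symp_eigenbasis_def)
      show "symp_orthonormal {1..m} (\<lambda>j. u (g j) t) (\<lambda>j. v (g j) t)"
        using n inj by (auto simp: symp_eigenbasis_def symp_basis_def symp_orthonormal_def)
    next
      fix j assume "j \<in> {1..m}"
      then show "d (g j) t0 = e" using g by (auto simp: bij_betw_def)
      qed (use an in auto)
    qed (use \<epsilon> sub in auto)
  next
    case 2
    show ?case
    proof (rule exI[of _ \<epsilon>], intro conjI, goal_cases)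
      case 3
      show ?case
      proof (rule exI[of _ d], rule exI[of _ u], rule exI[of _ v], intro conjI ballI)
      fix t assume "t \<in> {t0 - \<epsilon><..<t0 + \<epsilon>}"
      from near[OF dist[OF this]]
      show "\<exists>p. p permutes UNIV \<and> (\<forall>i. d i t = symp_eigval (A t) (p i))"
        and "symp_eigenbasis (A t) (\<lambda>i. d i t) (\<lambda>i. u i t) (\<lambda>i. v i t)"
        by auto
      qed (use an in auto)
    qed (use \<epsilon> sub in auto)
  qed
qed

end
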